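(* Let $N\geq 1$ and $m\geq 1$ be integers, and let $s\geq (m+1)^N$ be an integer. Let $Z\subset\mathbb{P}^N$ be a set of $s$ very general points in the complex projective space $\mathbb{P}^N=\mathbb{P}^N_{\mathbb{C}}$. Then $$\widehat{\alpha}(Z)\geq \frac{\alpha(mZ)+N-1}{m+N-1}.$$
   Context: We work over the field $\mathbb{C}$ of complex numbers. For a nonempty finite set of points $Z=\{P_1,\ldots,P_s\}\subset\mathbb{P}^N$ and an integer $m\geq 1$, let $I(P_i)\subset\mathbb{C}[x_0,\ldots,x_N]$ be the homogeneous ideal of the point $P_i$, and let $I^{(m)}(Z)=I(P_1)^m\cap\cdots\cap I(P_s)^m$ be the $m$-th symbolic power of the ideal of $Z$. The number $\alpha(mZ)$ is the least degree of a nonzero homogeneous polynomial in $I^{(m)}(Z)$, i.e. the least degree of a nonzero form vanishing to order at least $m$ at every point of $Z$. The Waldschmidt constant of $Z$ is $$\widehat{\alpha}(Z)=\lim_{m\to\infty}\frac{\alpha(mZ)}{m}=\inf_{m\geq 1}\frac{\alpha(mZ)}{m}$$ (the limit exists and equals the infimum). A statement holds for $s$ very general points of $\mathbb{P}^N$ if there is a countable union $B$ of proper Zariski-closed subsets of $(\mathbb{P}^N)^s$ such that it holds for all sets $\{P_1,\ldots,P_s\}$ of $s$ distinct points with $(P_1,\ldots,P_s)\in(\mathbb{P}^N)^s\setminus B$. *)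

theory Defs
  imports Complex_Main "HOL-Library.Countable_Set" "HOL-Library.FuncSet"
    "HOL-Library.Poly_Mapping" "HOL-Algebra.Ideal_Product"
begin

section \<open>Complex polynomials in several variables\<close>

text \<open>A polynomial is a finitely supported map from exponent vectors to coefficients; the
  multiplication of the type class is the convolution product. The variables are indexed by
  elements of the type \<open>'v\<close>, and a set \<open>V\<close> singles out the variables that may occur.\<close>

type_synonym 'v mpoly = "('v \<Rightarrow>\<^sub>0 nat) \<Rightarrow>\<^sub>0 complex"

definition polys :: "'v set \<Rightarrow> 'v mpoly set"
  where "polys V = {F. \<forall>e\<in>Poly_Mapping.keys F. Poly_Mapping.keys e \<subseteq> V}"

definition poly_ring :: "'v set \<Rightarrow> 'v mpoly ring"
  where "poly_ring V = \<lparr>carrier = polys V, mult = (*), one = 1, zero = 0, add = (+)\<rparr>"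

definition eval_poly :: "('v \<Rightarrow> complex) \<Rightarrow> 'v mpoly \<Rightarrow> complex"
  where "eval_poly v F = (\<Sum>e\<in>Poly_Mapping.keys F. Poly_Mapping.lookup F e *
           (\<Prod>i\<in>Poly_Mapping.keys e. v i ^ Poly_Mapping.lookup e i))"

text \<open>As usual, the zero polynomial is homogeneous of every degree.\<close>

definition homogeneous :: "nat \<Rightarrow> 'v mpoly \<Rightarrow> bool"
  where "homogeneous d F \<longleftrightarrow> (\<forall>e\<in>Poly_Mapping.keys F.
           (\<Sum>i\<in>Poly_Mapping.keys e. Poly_Mapping.lookup e i) = d)"

text \<open>The polynomial ring really is a ring; this matters because the ideal operations of
  the algebra library are only meaningful over one.\<close>

lemma cring_poly_ring: "cring (poly_ring V)"
proof (rule cringI)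
  have add: "F + G \<in> polys V" if "F \<in> polys V" "G \<in> polys V" for F G :: "'a mpoly"
    using that Poly_Mapping.keys_add[of F G] unfolding polys_def by blast
  have mult: "F * G \<in> polys V" if F: "F \<in> polys V" and G: "G \<in> polys V" for F G :: "'a mpoly"
    unfolding polys_def
  proof (intro CollectI ballI)
    fix e assume "e \<in> Poly_Mapping.keys (F * G)"
    then obtain a b where "e = a + b" "a \<in> Poly_Mapping.keys F" "b \<in> Poly_Mapping.keys G"
      using Poly_Mapping.keys_mult[of F G] by blast
    then show "Poly_Mapping.keys e \<subseteq> V"
      using F G Poly_Mapping.keys_add[of a b] unfolding polys_def by blast
  qed
  show "abelian_group (poly_ring V)"
  proof (rule abelian_groupI)
    fix F assume "F \<in> carrier (poly_ring V)"
    then show "\<exists>G\<in>carrier (poly_ring V). G \<oplus>\<^bsub>poly_ring V\<^esub> F = \<zero>\<^bsub>poly_ring V\<^esub>"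
      by (intro bexI[of _ "- F"]) (auto simp: poly_ring_def polys_def)
  qed (auto simp: poly_ring_def add algebra_simps, auto simp: polys_def)
  show "comm_monoid (poly_ring V)"
    by (rule comm_monoidI)
      (auto simp: poly_ring_def mult algebra_simps, auto simp: polys_def)
qed (auto simp: poly_ring_def algebra_simps)

section \<open>Projective space\<close>

text \<open>Vectors of \<open>\<complex>\<^bsup>N+1\<^esup>\<close> are functions on \<open>nat\<close> vanishing outside \<open>{..N}\<close>. A point of
  projective space is the set of all its homogeneous coordinate vectors.\<close>

definition nonzero_vectors :: "nat \<Rightarrow> (nat \<Rightarrow> complex) set"
  where "nonzero_vectors N = {v. (\<forall>i>N. v i = 0) \<and> (\<exists>i. v i \<noteq> 0)}"

definition proportional :: "nat \<Rightarrow> ((nat \<Rightarrow> complex) \<times> (nat \<Rightarrow> complex)) set"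
  where "proportional N = {(v, w). v \<in> nonzero_vectors N \<and> w \<in> nonzero_vectors N \<and>
           (\<exists>c. c \<noteq> 0 \<and> w = (\<lambda>i. c * v i))}"

definition proj_space :: "nat \<Rightarrow> (nat \<Rightarrow> complex) set set"
  where "proj_space N = nonzero_vectors N // proportional N"

lemma equiv_proportional: "equiv (nonzero_vectors N) (proportional N)"
proof (rule equivI)
  show "proportional N \<subseteq> nonzero_vectors N \<times> nonzero_vectors N"
    by (auto simp: proportional_def)
  show "refl_on (nonzero_vectors N) (proportional N)"
    by (auto simp: refl_on_def proportional_def intro!: exI[of _ 1])
  show "sym (proportional N)"
  proof (rule symI)
    fix v w assume *: "(v, w) \<in> proportional N"
    then obtain c where "c \<noteq> 0" "w = (\<lambda>i. c * v i)"
      unfolding proportional_def by blast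
    then have "v = (\<lambda>i. inverse c * w i)" "inverse c \<noteq> 0" by auto
    with * show "(w, v) \<in> proportional N" unfolding proportional_def by blast
  qed
  show "trans (proportional N)"
  proof (rule transI)
    fix u v w assume *: "(u, v) \<in> proportional N" "(v, w) \<in> proportional N"
    then obtain c d where "c \<noteq> 0" "v = (\<lambda>i. c * u i)" "d \<noteq> 0" "w = (\<lambda>i. d * v i)"
      unfolding proportional_def by blast
    then have "w = (\<lambda>i. (d * c) * u i)" "d * c \<noteq> 0" by auto
    with * show "(u, w) \<in> proportional N" unfolding proportional_def by blast
  qed
qed

section \<open>Symbolic powers and the Waldschmidt constant\<close>

text \<open>The homogeneous coordinate ring of projective \<open>N\<close>-space has the variables \<open>0, \<dots>, N\<close>.\<close>

abbreviation coord_ring :: "nat \<Rightarrow> nat mpoly ring"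
  where "coord_ring N \<equiv> poly_ring {..N}"

definition point_ideal :: "nat \<Rightarrow> (nat \<Rightarrow> complex) set \<Rightarrow> nat mpoly set"
  where "point_ideal N P = genideal (coord_ring N)
           {F \<in> carrier (coord_ring N). (\<exists>d. homogeneous d F) \<and> (\<forall>v\<in>P. eval_poly v F = 0)}"

text \<open>The power \<open>I(P)\<^sup>m\<close> is taken in the multiplicative monoid of ideals.\<close>

definition symbolic_power :: "nat \<Rightarrow> (nat \<Rightarrow> complex) set set \<Rightarrow> nat \<Rightarrow> nat mpoly set"
  where "symbolic_power N Z m =
           (\<Inter>P\<in>Z. point_ideal N P [^]\<^bsub>ideals_set (coord_ring N)\<^esub> m)"

definition alpha :: "nat \<Rightarrow> (nat \<Rightarrow> complex) set set \<Rightarrow> nat \<Rightarrow> nat"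
  where "alpha N Z m =
           (LEAST d. \<exists>F\<in>symbolic_power N Z m. F \<noteq> 0 \<and> homogeneous d F)"

definition waldschmidt :: "nat \<Rightarrow> (nat \<Rightarrow> complex) set set \<Rightarrow> real"
  where "waldschmidt N Z = lim (\<lambda>m. real (alpha N Z m) / real m)"

section \<open>Very general points\<close>

definition proj_tuples :: "nat \<Rightarrow> nat \<Rightarrow> (nat \<Rightarrow> (nat \<Rightarrow> complex) set) set"
  where "proj_tuples N s = {..<s} \<rightarrow>\<^sub>E proj_space N"

text \<open>Closed subsets of the \<open>s\<close>-fold product are the common zero sets of polynomials in the
  variables \<open>(i, j)\<close>, the \<open>j\<close>-th homogeneous coordinate of the \<open>i\<close>-th point, that are
  homogeneous in each of the \<open>s\<close> groups of variables separately.\<close>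

definition multihomogeneous :: "nat \<Rightarrow> nat \<Rightarrow> (nat \<times> nat) mpoly \<Rightarrow> bool"
  where "multihomogeneous N s F \<longleftrightarrow> F \<in> polys ({..<s} \<times> {..N}) \<and>
           (\<exists>d. \<forall>e\<in>Poly_Mapping.keys F. \<forall>i<s. (\<Sum>j\<le>N. Poly_Mapping.lookup e (i, j)) = d i)"

definition zero_locus :: "nat \<Rightarrow> nat \<Rightarrow> (nat \<times> nat) mpoly set \<Rightarrow> (nat \<Rightarrow> (nat \<Rightarrow> complex) set) set"
  where "zero_locus N s S = {P \<in> proj_tuples N s. \<forall>F\<in>S. \<forall>v.
           (\<forall>i<s. v i \<in> P i) \<longrightarrow> eval_poly (\<lambda>(i, j). v i j) F = 0}"

definition zariski_closed :: "nat \<Rightarrow> nat \<Rightarrow> (nat \<Rightarrow> (nat \<Rightarrow> complex) set) set \<Rightarrow> bool"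
  where "zariski_closed N s A \<longleftrightarrow>
           (\<exists>S. (\<forall>F\<in>S. multihomogeneous N s F) \<and> A = zero_locus N s S)"

definition holds_very_general ::
    "nat \<Rightarrow> nat \<Rightarrow> ((nat \<Rightarrow> complex) set set \<Rightarrow> bool) \<Rightarrow> bool"
  where "holds_very_general N s Q \<longleftrightarrow>
           (\<exists>\<C>. countable \<C> \<and>
             (\<forall>A\<in>\<C>. zariski_closed N s A \<and> A \<noteq> proj_tuples N s) \<and>
             (\<forall>P\<in>proj_tuples N s - \<Union>\<C>. inj_on P {..<s} \<longrightarrow> Q (P ` {..<s})))"

end

theory Submission
  imports Defs "HOL-Computational_Algebra.Polynomial"
begin

text \<open>By a dimension count, \<open>alpha N Z m \<le> d\<close> as soon as
  \<open>s * ((m - 1 + N) choose N) < (d + N) choose N\<close>. It therefore suffices to bound the Waldschmidt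
  constant below by some \<open>c \<ge> (d + N - 1) / (m + N - 1)\<close>. Having no form of degree \<open>d < c * M\<close> with
  multiplicity \<open>M\<close> at the points means that a matrix whose entries are multihomogeneous in the points
  has trivial kernel, so this only has to be checked at a single tuple for each of the countably many
  pairs \<open>(M, d)\<close>.

  Let \<open>k\<close> be the integral part of the \<open>N\<close>-th root of \<open>s\<close>. Special tuples consist of points on
  parallel hyperplanes: after splitting off the hyperplanes, with multiplicities \<open>b a\<close>, a form of
  degree \<open>d\<close> restricts to a nonzero form of degree \<open>D = d - (\<Sum>a. b a)\<close> on each of them, and induction
  on the dimension applies. A grid of \<open>k ^ N\<close> points gives \<open>c = k\<close>, which is enough unless \<open>N = 2\<close> and
  \<open>s > k * (k + 1)\<close>; in that case \<open>k\<close> lines with \<open>k + 1\<close> points and one line with the remaining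
  \<open>j = s - k * (k + 1)\<close> points give \<open>c = k + j / (k + 1)\<close>.\<close>

section \<open>Evaluation and gradings of polynomials\<close>

text \<open>Evaluation, restriction to a line and changes of coordinates are all of this kind, so
  one set of rules serves them all.\<close>

definition ring_map :: "('a::comm_ring_1 \<Rightarrow> 'b::comm_ring_1) \<Rightarrow> bool"
  where "ring_map h \<longleftrightarrow> h 0 = 0 \<and> h 1 = 1 \<and>
    (\<forall>a b. h (a + b) = h a + h b) \<and> (\<forall>a b. h (a * b) = h a * h b)"

lemma ring_map_sum: "ring_map h \<Longrightarrow> h (sum f A) = (\<Sum>a\<in>A. h (f a))"
  by (induction A rule: infinite_finite_induct) (auto simp: ring_map_def)

lemma ring_map_prod: "ring_map h \<Longrightarrow> h (prod f A) = (\<Prod>a\<in>A. h (f a))"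
  by (induction A rule: infinite_finite_induct) (auto simp: ring_map_def)

lemma ring_map_power: "ring_map h \<Longrightarrow> h (a ^ n) = h a ^ n"
  by (induction n) (auto simp: ring_map_def)

lemma ring_map_uminus: "ring_map h \<Longrightarrow> h (- a) = - h a"
  unfolding ring_map_def by (metis add.right_inverse add_eq_0_iff)

lemma ring_map_diff: "ring_map h \<Longrightarrow> h (a - b) = h a - h b"
  using ring_map_uminus[of h b] unfolding ring_map_def by (metis diff_conv_add_uminus)

lemma poly_mapping_sum_monomials:
  "(\<Sum>k\<in>Poly_Mapping.keys f. Poly_Mapping.single k (Poly_Mapping.lookup f k)) = f"
  by (rule poly_mapping_eqI) (auto simp: lookup_sum lookup_single when_def in_keys_iff)

definition Const :: "complex \<Rightarrow> 'v mpoly"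
  where "Const c = Poly_Mapping.single 0 c"

definition Var :: "'v \<Rightarrow> 'v mpoly"
  where "Var i = Poly_Mapping.single (Poly_Mapping.single i 1) 1"

text \<open>The universal property of the polynomial ring: \<open>h\<close> acts on the
  coefficients, \<open>x\<close> gives the images of the variables. \<open>eval_poly\<close>,
  \<open>line\<close>, \<open>cut\<close> and \<open>univ_line\<close> are instances.\<close>

definition subst :: "(complex \<Rightarrow> 'a::comm_ring_1) \<Rightarrow> ('v \<Rightarrow> 'a) \<Rightarrow> 'v mpoly \<Rightarrow> 'a"
  where "subst h x F = (\<Sum>e\<in>Poly_Mapping.keys F. h (Poly_Mapping.lookup F e) *
           (\<Prod>i\<in>Poly_Mapping.keys e. x i ^ Poly_Mapping.lookup e i))"

lemma eval_poly_eq_subst: "eval_poly v = subst (\<lambda>c. c) v"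
  by (simp add: eval_poly_def subst_def fun_eq_iff)

lemma ring_map_id: "ring_map (\<lambda>c. c)"
  by (simp add: ring_map_def)

lemma ring_map_Const: "ring_map Const"
  by (simp add: ring_map_def Const_def single_add mult_single)

lemma prod_keys_add:
  "(\<Prod>i\<in>Poly_Mapping.keys (e + e'). (x i :: 'a::comm_monoid_mult) ^ Poly_Mapping.lookup (e + e') i) =
   (\<Prod>i\<in>Poly_Mapping.keys e. x i ^ Poly_Mapping.lookup e i) *
   (\<Prod>i\<in>Poly_Mapping.keys e'. x i ^ Poly_Mapping.lookup e' i)"
proof -
  have *: "(\<Prod>i\<in>Poly_Mapping.keys p. x i ^ Poly_Mapping.lookup p i) =
      (\<Prod>i\<in>Poly_Mapping.keys e \<union> Poly_Mapping.keys e'. x i ^ Poly_Mapping.lookup p i)"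
    if "Poly_Mapping.keys p \<subseteq> Poly_Mapping.keys e \<union> Poly_Mapping.keys e'" for p
    by (rule prod.mono_neutral_left) (use that in \<open>auto simp: in_keys_iff\<close>)
  show ?thesis
    using *[of e] *[of e'] *[OF Poly_Mapping.keys_add]
    by (simp add: lookup_add power_add prod.distrib)
qed

lemma subst_single:
  "h 0 = 0 \<Longrightarrow> subst h x (Poly_Mapping.single e c) =
     h c * (\<Prod>i\<in>Poly_Mapping.keys e. x i ^ Poly_Mapping.lookup e i)"
  by (cases "c = 0") (auto simp: subst_def)

lemma subst_add:
  assumes "ring_map h" shows "subst h x (F + G) = subst h x F + subst h x G"
  unfolding subst_def using assms
  by (intro setsum_keys_plus_distrib) (auto simp: ring_map_def distrib_right)

lemma subst_sum:
  assumes "ring_map h" shows "subst h x (sum F A) = (\<Sum>a\<in>A. subst h x (F a))"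
  using assms by (induction A rule: infinite_finite_induct) (auto simp: subst_add, auto simp: subst_def)

lemma subst_mult:
  assumes h: "ring_map h" shows "subst h x (F * G) = subst h x F * subst h x G"
proof -
  have h0: "h 0 = 0" using h by (simp add: ring_map_def)
  have s: "subst h x (Poly_Mapping.single a b * Poly_Mapping.single c d) =
      subst h x (Poly_Mapping.single a b) * subst h x (Poly_Mapping.single c d)" for a b c d
    using h by (simp add: mult_single subst_single[of h, OF h0] prod_keys_add) (simp add: ring_map_def ac_simps)
  define m where "m F a = Poly_Mapping.single a (Poly_Mapping.lookup F a)" for F :: "'b mpoly" and a
  have m: "(\<Sum>a\<in>Poly_Mapping.keys F. m F a) = F" for F :: "'b mpoly"
    unfolding m_def by (rule poly_mapping_sum_monomials)
  have "subst h x ((\<Sum>a\<in>A. m F a) * (\<Sum>b\<in>B. m G b)) =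
      subst h x (\<Sum>a\<in>A. m F a) * subst h x (\<Sum>b\<in>B. m G b)" for A B
    unfolding sum_product subst_sum[OF h] by (simp add: m_def s)
  from this[of "Poly_Mapping.keys F" "Poly_Mapping.keys G"] show ?thesis
    unfolding m .
qed

lemma ring_map_subst: "ring_map h \<Longrightarrow> ring_map (subst h x)"
  using subst_single[of h x 0 1]
  unfolding ring_map_def[of "subst h x"]
  by (auto simp: subst_add subst_mult) (auto simp: subst_def ring_map_def)

lemma subst_Const: "ring_map h \<Longrightarrow> subst h x (Const c) = h c"
  by (simp add: Const_def subst_single ring_map_def)

lemma subst_Var: "ring_map h \<Longrightarrow> subst h x (Var i) = x i"
  by (simp add: Var_def subst_single ring_map_def)

text \<open>A ring map after a substitution is again a substitution, so composites are compared by
  their effect on constants and variables.\<close>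

lemma ring_map_of_subst:
  assumes "ring_map g"
  shows "g (subst h x F) = subst (\<lambda>c. g (h c)) (\<lambda>i. g (x i)) F"
  using assms unfolding subst_def
  by (simp add: ring_map_sum[OF assms] ring_map_prod[OF assms] ring_map_power[OF assms])
     (simp add: ring_map_def ring_map_prod[OF assms] ring_map_power[OF assms])

lemma single_eq_Const_mult:
  "Poly_Mapping.single e c = Const c * (\<Prod>i\<in>Poly_Mapping.keys e. Var i ^ Poly_Mapping.lookup e i)"
proof -
  have pw: "Var i ^ n = Poly_Mapping.single (Poly_Mapping.single i n) 1" for i :: 'a and n
    by (induction n) (auto simp: Var_def mult_single single_add[symmetric])
  have pr: "(\<Prod>i\<in>A. Poly_Mapping.single (Poly_Mapping.single i (n i)) (1::complex)) =
      Poly_Mapping.single (\<Sum>i\<in>A. Poly_Mapping.single i (n i)) 1" for A :: "'a set" and n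
    by (induction A rule: infinite_finite_induct) (auto simp: mult_single)
  show ?thesis
    unfolding pw pr Const_def mult_single poly_mapping_sum_monomials by simp
qed

lemma subst_Const_Var: "subst Const Var F = F"
  unfolding subst_def single_eq_Const_mult[symmetric] by (rule poly_mapping_sum_monomials)

text \<open>Covers both the total degree and the degree in the coordinates of a single point of a tuple.\<close>

definition additive_deg :: "(('v \<Rightarrow>\<^sub>0 nat) \<Rightarrow> nat) \<Rightarrow> bool"
  where "additive_deg g \<longleftrightarrow> g 0 = 0 \<and> (\<forall>a b. g (a + b) = g a + g b)"

definition graded :: "'v set \<Rightarrow> (('v \<Rightarrow>\<^sub>0 nat) \<Rightarrow> nat) \<Rightarrow> nat \<Rightarrow> 'v mpoly \<Rightarrow> bool"
  where "graded V g d F \<longleftrightarrow>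
    (\<forall>e\<in>Poly_Mapping.keys F. Poly_Mapping.keys e \<subseteq> V \<and> g e = d)"

lemma graded_0: "graded V g d 0"
  by (simp add: graded_def)

lemma graded_add: "graded V g d F \<Longrightarrow> graded V g d G \<Longrightarrow> graded V g d (F + G)"
  using Poly_Mapping.keys_add[of F G] unfolding graded_def by blast

lemma graded_uminus: "graded V g d F \<Longrightarrow> graded V g d (- F)"
  by (simp add: graded_def)

lemma graded_diff: "graded V g d F \<Longrightarrow> graded V g d G \<Longrightarrow> graded V g d (F - G)"
  using graded_add[OF _ graded_uminus, of V g d F G] by simp

lemma graded_mult:
  assumes "additive_deg g" "graded V g d F" "graded V g d' G"
  shows "graded V g (d + d') (F * G)"
  unfolding graded_def
proof
  fix e assume "e \<in> Poly_Mapping.keys (F * G)"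
  then obtain a b where e: "e = a + b" and "a \<in> Poly_Mapping.keys F" "b \<in> Poly_Mapping.keys G"
    using Poly_Mapping.keys_mult[of F G] by blast
  then show "Poly_Mapping.keys e \<subseteq> V \<and> g e = d + d'"
    using assms Poly_Mapping.keys_add[of a b] unfolding graded_def additive_deg_def
    by (metis Un_least order_trans)
qed

lemma graded_Const: "additive_deg g \<Longrightarrow> graded V g 0 (Const c)"
  by (simp add: graded_def Const_def additive_deg_def)

lemma graded_Var: "i \<in> V \<Longrightarrow> g (Poly_Mapping.single i 1) = d \<Longrightarrow> graded V g d (Var i)"
  by (simp add: graded_def Var_def)

lemma graded_polys: "graded V g d F \<Longrightarrow> F \<in> polys V"
  by (auto simp: graded_def polys_def)

section \<open>Forms of a given total degree\<close>

definition total_deg :: "('v \<Rightarrow>\<^sub>0 nat) \<Rightarrow> nat"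
  where "total_deg e = (\<Sum>i\<in>Poly_Mapping.keys e. Poly_Mapping.lookup e i)"

lemma additive_total_deg: "additive_deg total_deg"
  unfolding additive_deg_def total_deg_def
  by (auto intro: setsum_keys_plus_distrib[of "\<lambda>_ n. n"])

abbreviation form :: "'v set \<Rightarrow> nat \<Rightarrow> 'v mpoly \<Rightarrow> bool"
  where "form V \<equiv> graded V total_deg"

lemma form_iff: "form V d F \<longleftrightarrow> F \<in> polys V \<and> homogeneous d F"
  by (auto simp: graded_def polys_def homogeneous_def total_deg_def)

lemmas form_mult = graded_mult[OF additive_total_deg]
lemmas form_Const = graded_Const[OF additive_total_deg]

lemma form_Var: "i \<in> V \<Longrightarrow> form V 1 (Var i)"
  by (rule graded_Var) (auto simp: total_deg_def)

text \<open>Every form arises from constants and variables by products, which add degrees, and by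
  sums within one degree. The cases do not supply that \<open>F\<close> and \<open>G\<close> are
  forms, so \<open>P\<close> has to carry this where a proof uses it.\<close>

lemma form_induct [consumes 1, case_names zero add Const Var mult]:
  assumes F: "form V d F"
    and zero: "\<And>d. P d 0"
    and add: "\<And>d F G. P d F \<Longrightarrow> P d G \<Longrightarrow> P d (F + G)"
    and Const: "\<And>c. P 0 (Const c)"
    and Var: "\<And>i. i \<in> V \<Longrightarrow> P 1 (Var i)"
    and mult: "\<And>d d' F G. P d F \<Longrightarrow> P d' G \<Longrightarrow> P (d + d') (F * G)"
  shows "P d F"
proof -
  have one: "P 0 1" using Const[of 1] by (simp add: Const_def)
  have pw: "P n (Var i ^ n)" if "i \<in> V" for i n
    using mult[OF Var[OF that]] one by (induction n) auto
  have pr: "P (\<Sum>i\<in>A. n i) (\<Prod>i\<in>A. Var i ^ n i)" if "finite A" "A \<subseteq> V" for A n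
    using that by (induction A) (auto simp: one intro: mult pw)
  have mon: "P d (Poly_Mapping.single e c)" if "Poly_Mapping.keys e \<subseteq> V" "total_deg e = d" for e c
    using mult[OF Const[of c] pr[of "Poly_Mapping.keys e" "Poly_Mapping.lookup e"]] that
    unfolding single_eq_Const_mult by (simp add: total_deg_def)
  have "P d (\<Sum>e\<in>A. Poly_Mapping.single e (Poly_Mapping.lookup F e))"
    if "finite A" "A \<subseteq> Poly_Mapping.keys F" for A
    using that F by (induction A) (auto simp: zero graded_def intro!: add mon)
  from this[of "Poly_Mapping.keys F"] show ?thesis
    by (simp add: poly_mapping_sum_monomials)
qed

lemma poly_ring_idealI:
  assumes "K \<subseteq> polys V" "0 \<in> K" "\<And>F G. F \<in> K \<Longrightarrow> G \<in> K \<Longrightarrow> F + G \<in> K"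
    and "\<And>F G. F \<in> polys V \<Longrightarrow> G \<in> K \<Longrightarrow> F * G \<in> K"
  shows "ideal K (poly_ring V)"
proof -
  interpret cring "poly_ring V" by (rule cring_poly_ring)
  have carr: "carrier (poly_ring V) = polys V" by (simp add: poly_ring_def)
  have minus: "\<ominus>\<^bsub>poly_ring V\<^esub> F \<in> K" if "F \<in> K" for F
  proof -
    have "\<ominus>\<^bsub>poly_ring V\<^esub> F = (\<ominus>\<^bsub>poly_ring V\<^esub> \<one>\<^bsub>poly_ring V\<^esub>) \<otimes>\<^bsub>poly_ring V\<^esub> F"
      using that assms(1) carr by (subst l_minus) auto
    also have "\<dots> \<in> K"
      using assms(4)[OF _ that] a_inv_closed[OF one_closed] by (simp add: carr) (simp add: poly_ring_def)
    finally show ?thesis .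
  qed
  show ?thesis
  proof (rule idealI[OF ring_axioms])
    show "subgroup K (add_monoid (poly_ring V))"
      unfolding subgroup_def a_inv_def[symmetric] using assms(1-3) minus
      by (auto simp: carr) (auto simp: poly_ring_def)
    show "a \<otimes>\<^bsub>poly_ring V\<^esub> b \<in> K" if "b \<in> K" "a \<in> carrier (poly_ring V)" for a b
      using that assms(4) by (simp add: poly_ring_def)
    show "b \<otimes>\<^bsub>poly_ring V\<^esub> a \<in> K" if "b \<in> K" "a \<in> carrier (poly_ring V)" for a b
      using that assms(4) by (simp add: poly_ring_def mult.commute)
  qed
qed

section \<open>Powers of the ideal of a point\<close>

abbreviation ipow :: "nat \<Rightarrow> (nat \<Rightarrow> complex) set \<Rightarrow> nat \<Rightarrow> nat mpoly set"
  where "ipow N P m \<equiv> point_ideal N P [^]\<^bsub>ideals_set (coord_ring N)\<^esub> m"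

lemma carrier_poly_ring: "carrier (poly_ring V) = polys V"
  by (simp add: poly_ring_def)

lemma mult_poly_ring: "F \<otimes>\<^bsub>poly_ring V\<^esub> G = F * G"
  by (simp add: poly_ring_def)

lemma add_poly_ring: "F \<oplus>\<^bsub>poly_ring V\<^esub> G = F + G"
  by (simp add: poly_ring_def)

lemma polys_add: "F \<in> polys V \<Longrightarrow> G \<in> polys V \<Longrightarrow> F + G \<in> polys V"
  using cring.cring_simprules(1)[OF cring_poly_ring, of F V G]
  by (simp add: carrier_poly_ring add_poly_ring)

lemma polys_mult: "F \<in> polys V \<Longrightarrow> G \<in> polys V \<Longrightarrow> F * G \<in> polys V"
  using cring.cring_simprules(5)[OF cring_poly_ring, of F V G]
  by (simp add: carrier_poly_ring mult_poly_ring)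

lemma monoid_ideals_set: "comm_monoid (ideals_set (poly_ring V))"
  by (rule cring.ideals_set_is_comm_monoid[OF cring_poly_ring])

lemma ideal_point_ideal: "ideal (point_ideal N P) (coord_ring N)"
  unfolding point_ideal_def
  by (rule ring.genideal_ideal[OF cring.axioms(1)[OF cring_poly_ring]]) auto

lemma point_ideal_carrier: "point_ideal N P \<in> carrier (ideals_set (coord_ring N))"
  by (simp add: ideals_set_def ideal_point_ideal)

lemma ideal_ipow: "ideal (ipow N P m) (coord_ring N)"
  using monoid.nat_pow_closed[OF comm_monoid.axioms(1)[OF monoid_ideals_set] point_ideal_carrier]
  by (simp add: ideals_set_def)

lemma ipow_0: "ipow N P 0 = polys {..N}"
  by (simp add: ideals_set_def poly_ring_def)

lemma one_in_ipow_0: "1 \<in> ipow N P 0"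
  unfolding ipow_0 by (simp add: polys_def)

lemma ipow_1: "ipow N P 1 = point_ideal N P"
  using monoid.l_one[OF comm_monoid.axioms(1)[OF monoid_ideals_set] point_ideal_carrier]
  by simp

lemma ipow_plus: "ipow N P (m + n) = ideal_prod (coord_ring N) (ipow N P m) (ipow N P n)"
  using monoid.nat_pow_mult[OF comm_monoid.axioms(1)[OF monoid_ideals_set] point_ideal_carrier, of N P m n]
  by (simp add: ideals_set_def)

lemma ipow_mult:
  assumes "F \<in> ipow N P m" "G \<in> ipow N P n" shows "F * G \<in> ipow N P (m + n)"
  unfolding ipow_plus using ideal_prod.prod[OF assms, of "coord_ring N"]
  by (simp add: mult_poly_ring)

lemma ipow_add: "F \<in> ipow N P m \<Longrightarrow> G \<in> ipow N P m \<Longrightarrow> F + G \<in> ipow N P m"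
  using additive_subgroup.a_closed[OF ideal.axioms(1)[OF ideal_ipow]] by (simp add: add_poly_ring)

lemma zero_in_ipow: "0 \<in> ipow N P m"
  using additive_subgroup.zero_closed[OF ideal.axioms(1)[OF ideal_ipow]] by (simp add: poly_ring_def)

lemma ipow_sum: "(\<And>a. a \<in> A \<Longrightarrow> F a \<in> ipow N P m) \<Longrightarrow> sum F A \<in> ipow N P m"
  by (induction A rule: infinite_finite_induct) (auto simp: zero_in_ipow ipow_add)

lemma ipow_subset_polys: "ipow N P m \<subseteq> polys {..N}"
  using additive_subgroup.a_subset[OF ideal.axioms(1)[OF ideal_ipow]] by (simp add: carrier_poly_ring)

text \<open>The higher power is a product with the lower one as a factor, and a product of ideals
  lies in each factor.\<close>

lemma ipow_antimono:
  assumes "m \<le> n" shows "ipow N P n \<subseteq> ipow N P m"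
  using ring.ideal_prod_inter[OF cring.axioms(1)[OF cring_poly_ring] ideal_ipow ideal_ipow, of N P m P "n - m"] assms
  unfolding ipow_plus[symmetric] by auto

lemma ipow_power: "F \<in> ipow N P m \<Longrightarrow> F ^ n \<in> ipow N P (n * m)"
  using one_in_ipow_0 by (induction n) (auto simp: ipow_mult simp del: nat_pow_0)

lemma ipow_prod: "(\<And>a. a \<in> A \<Longrightarrow> F a \<in> ipow N P (n a)) \<Longrightarrow> prod F A \<in> ipow N P (sum n A)"
  using one_in_ipow_0
  by (induction A rule: infinite_finite_induct) (auto simp: ipow_mult)

section \<open>Vanishing order along lines\<close>

definition line :: "('v \<Rightarrow> complex) \<Rightarrow> ('v \<Rightarrow> complex) \<Rightarrow> 'v mpoly \<Rightarrow> complex poly"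
  where "line v w = subst (\<lambda>c. [:c:]) (\<lambda>i. [:v i, w i:])"

text \<open>Multiplicity is measured on the restrictions to all lines \<open>v + t * w\<close>, with
  \<open>[:0, 1:]\<close> as the parameter \<open>t\<close>. By \<open>ipow_vanishes\<close> it
  follows from membership in a power of the point ideal; all lower bounds for degrees are proved in
  this form.\<close>

definition vanishes :: "nat \<Rightarrow> ('v \<Rightarrow> complex) \<Rightarrow> 'v mpoly \<Rightarrow> bool"
  where "vanishes m v F \<longleftrightarrow> (\<forall>w. [:0, 1:] ^ m dvd line v w F)"

lemma ring_map_pCons: "ring_map (\<lambda>c. [:c:])"
  by (auto simp: ring_map_def one_pCons)

lemma ring_map_line: "ring_map (line v w)"
  unfolding line_def by (rule ring_map_subst[OF ring_map_pCons])

lemma ring_map_poly: "ring_map (\<lambda>p. poly p a)"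
  by (simp add: ring_map_def)

lemma poly_line: "poly (line v w F) t = eval_poly (\<lambda>i. v i + t * w i) F"
  unfolding line_def eval_poly_eq_subst ring_map_of_subst[OF ring_map_poly] by simp

lemma vanishes_add: "vanishes m v F \<Longrightarrow> vanishes m v G \<Longrightarrow> vanishes m v (F + G)"
  using ring_map_line[of v] unfolding vanishes_def ring_map_def by auto

lemma vanishes_mult: "vanishes m v F \<Longrightarrow> vanishes n v G \<Longrightarrow> vanishes (m + n) v (F * G)"
  using ring_map_line[of v] unfolding vanishes_def ring_map_def by (auto simp: power_add mult_dvd_mono)

lemma vanishes_0: "vanishes 0 v F"
  by (simp add: vanishes_def)

lemma vanishes_zero: "vanishes m v 0"
  using ring_map_line[of v] by (simp add: vanishes_def ring_map_def)

text \<open>The polynomials of order at least 1 at \<open>v\<close> form an ideal that contains the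
  generators of \<open>point_ideal N P\<close>, hence the ideal they generate.\<close>

lemma point_ideal_vanishes:
  assumes "v \<in> P" "F \<in> point_ideal N P"
  shows "vanishes 1 v F"
proof -
  let ?K = "{F \<in> polys {..N}. vanishes 1 v F}"
  have "ideal ?K (coord_ring N)"
    by (rule poly_ring_idealI)
      (use vanishes_mult[OF vanishes_0] in \<open>auto simp: vanishes_zero polys_add polys_mult vanishes_add,
        auto simp: polys_def\<close>)
  moreover have "vanishes 1 v G" if "\<forall>v\<in>P. eval_poly v G = 0" for G
    unfolding vanishes_def
  proof
    fix w
    have "poly (line v w G) 0 = 0"
      using that assms(1) by (simp add: poly_line)
    then show "[:0, 1:] ^ 1 dvd line v w G"
      by (simp add: poly_eq_0_iff_dvd)
  qed
  ultimately show ?thesis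
    using assms(2) unfolding point_ideal_def genideal_def by (auto simp: carrier_poly_ring)
qed

lemma ipow_vanishes:
  assumes "v \<in> P" "F \<in> ipow N P m"
  shows "vanishes m v F"
  using assms(2)
proof (induction m arbitrary: F)
  case (Suc m)
  have "F \<in> ideal_prod (coord_ring N) (ipow N P m) (point_ideal N P)"
    using Suc.prems ipow_plus[of N P m 1] unfolding ipow_1 by simp
  then show ?case
  proof induction
    case (prod i j)
    then show ?case
      using vanishes_mult[OF Suc.IH point_ideal_vanishes[OF assms(1)]] by (simp add: mult_poly_ring)
  qed (auto simp: add_poly_ring vanishes_add)
qed (rule vanishes_0)

section \<open>Forms vanishing at given points\<close>

text \<open>Elimination, one equation at a time: either the new equation is trivial on
  \<open>C\<close>, or it is solved for an unknown \<open>c0\<close>, which leaves one unknown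
  fewer.\<close>

lemma homogeneous_system_solution:
  fixes A :: "'r \<Rightarrow> 'c \<Rightarrow> 'a::field"
  assumes "finite R" "finite C" "card R < card C"
  shows "\<exists>x. (\<exists>c\<in>C. x c \<noteq> 0) \<and> (\<forall>r\<in>R. (\<Sum>c\<in>C. A r c * x c) = 0)"
  using assms
proof (induction R arbitrary: C A)
  case empty
  then have "C \<noteq> {}" by auto
  then show ?case by (intro exI[of _ "\<lambda>_. 1"]) auto
next
  case (insert r R)
  show ?case
  proof (cases "\<forall>c\<in>C. A r c = 0")
    case True
    have "card R < card C" using insert by simp
    from insert.IH[OF insert.prems(1) this, of A] obtain x where
      "\<exists>c\<in>C. x c \<noteq> 0" "\<forall>r\<in>R. (\<Sum>c\<in>C. A r c * x c) = 0" by blast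
    with True show ?thesis by (intro exI[of _ x]) simp
  next
    case False
    then obtain c0 where c0: "c0 \<in> C" "A r c0 \<noteq> 0" by blast
    have "card R < card (C - {c0})" using insert c0 by simp
    from insert.IH[OF _ this, of "\<lambda>r' c. A r' c - A r' c0 * A r c / A r c0"] insert.prems
    obtain y where y: "\<exists>c\<in>C-{c0}. y c \<noteq> 0"
      and yA: "\<And>r'. r' \<in> R \<Longrightarrow> (\<Sum>c\<in>C-{c0}. (A r' c - A r' c0 * A r c / A r c0) * y c) = 0"
      by auto
    define S where "S = (\<Sum>c\<in>C-{c0}. A r c * y c)"
    define x where "x = y(c0 := - S / A r c0)"
    have sum: "(\<Sum>c\<in>C. A r' c * x c) = - A r' c0 * S / A r c0 + (\<Sum>c\<in>C-{c0}. A r' c * y c)" for r'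
      using sum.remove[OF insert.prems(1) c0(1), of "\<lambda>c. A r' c * x c"] by (simp add: x_def)
    have "(\<Sum>c\<in>C. A r' c * x c) = 0" if "r' \<in> insert r R" for r'
    proof (cases "r' = r")
      case True
      then show ?thesis using c0 unfolding sum by (simp add: S_def)
    next
      case False
      have "(\<Sum>c\<in>C-{c0}. A r' c * y c) - A r' c0 / A r c0 * S =
          (\<Sum>c\<in>C-{c0}. (A r' c - A r' c0 * A r c / A r c0) * y c)"
        unfolding S_def sum_distrib_left sum_subtractf[symmetric]
        by (rule sum.cong) (auto simp: left_diff_distrib)
      also have "\<dots> = 0" using yA[of r'] that False by simp
      finally show ?thesis unfolding sum by simp
    qed
    moreover have "\<exists>c\<in>C. x c \<noteq> 0" using y by (auto simp: x_def)
    ultimately show ?thesis by blast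
  qed
qed

section \<open>Counting monomials\<close>

definition monomials :: "nat \<Rightarrow> nat \<Rightarrow> (nat \<Rightarrow>\<^sub>0 nat) set"
  where "monomials N d = {e. Poly_Mapping.keys e \<subseteq> {..N} \<and> total_deg e = d}"

lemma form_keys: "form {..N} d F \<longleftrightarrow> Poly_Mapping.keys F \<subseteq> monomials N d"
  by (auto simp: graded_def monomials_def)

lemma total_deg_eq:
  fixes N :: nat
  shows "Poly_Mapping.keys e \<subseteq> {..N} \<Longrightarrow> total_deg e = (\<Sum>i\<le>N. Poly_Mapping.lookup e i)"
  unfolding total_deg_def by (rule sum.mono_neutral_left) (auto simp: in_keys_iff)

lemma atLeast0_lessThan_Suc_eq_atMost: "{0..<Suc N} = {..N}"
  by auto

text \<open>Exponent vectors become lists of \<open>N + 1\<close> naturals with sum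
  \<open>d\<close>, which \<open>card_length_sum_list\<close> counts.\<close>

lemma bij_betw_monomials:
  "bij_betw (\<lambda>e. map (Poly_Mapping.lookup e) [0..<Suc N]) (monomials N d)
     {l. length l = Suc N \<and> sum_list l = d}"
proof (rule bij_betwI')
  fix e e' assume e: "e \<in> monomials N d" "e' \<in> monomials N d"
  show "map (Poly_Mapping.lookup e) [0..<Suc N] = map (Poly_Mapping.lookup e') [0..<Suc N] \<longleftrightarrow> e = e'"
  proof
    assume "map (Poly_Mapping.lookup e) [0..<Suc N] = map (Poly_Mapping.lookup e') [0..<Suc N]"
    then have 1: "Poly_Mapping.lookup e i = Poly_Mapping.lookup e' i" if "i \<le> N" for i
      unfolding map_eq_conv using that by auto
    have 2: "Poly_Mapping.lookup e i = 0 \<and> Poly_Mapping.lookup e' i = 0" if "\<not> i \<le> N" for i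
      using e that unfolding monomials_def by (auto simp: in_keys_iff subset_iff)
    show "e = e'" using 1 2 by (intro poly_mapping_eqI) metis
  qed simp
next
  fix e assume "e \<in> monomials N d"
  then show "map (Poly_Mapping.lookup e) [0..<Suc N] \<in> {l. length l = Suc N \<and> sum_list l = d}"
    using total_deg_eq[of e N] unfolding monomials_def
    by (simp add: interv_sum_list_conv_sum_set_nat atLeast0_lessThan_Suc_eq_atMost del: upt_Suc)
next
  fix l :: "nat list" assume l: "l \<in> {l. length l = Suc N \<and> sum_list l = d}"
  define e where "e = Abs_poly_mapping (\<lambda>i. if i \<le> N then l ! i else 0)"
  have le: "Poly_Mapping.lookup e i = (if i \<le> N then l ! i else 0)" for i
    unfolding e_def by (subst lookup_Abs_poly_mapping) (auto intro: finite_subset[of _ "{..N}"])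
  have k: "Poly_Mapping.keys e \<subseteq> {..N}" by (auto simp: in_keys_iff le split: if_splits)
  have "map (Poly_Mapping.lookup e) [0..<Suc N] = l"
    using l by (intro nth_equalityI) (auto simp: le simp del: upt_Suc)
  moreover have "e \<in> monomials N d"
    using l k total_deg_eq[OF k] sum_list_sum_nth[of l] unfolding monomials_def
    by (auto simp: le atLeast0_lessThan_Suc_eq_atMost)
  ultimately show "\<exists>e\<in>monomials N d. l = map (Poly_Mapping.lookup e) [0..<Suc N]"
    by metis
qed

lemma card_monomials: "card (monomials N d) = (d + N) choose N"
  using bij_betw_same_card[OF bij_betw_monomials[of N d]] binomial_symmetric[of N "d + N"]
  by (simp add: card_length_sum_list)

lemma finite_monomials: "finite (monomials N d)"
  by (rule card_ge_0_finite) (simp add: card_monomials)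

lemma lookup_Const_mult: "Poly_Mapping.lookup (Const c * F) e = c * Poly_Mapping.lookup F e"
proof -
  have "Const c * F = (\<Sum>k\<in>Poly_Mapping.keys F. Poly_Mapping.single k (c * Poly_Mapping.lookup F k))"
    by (subst (1) poly_mapping_sum_monomials[symmetric])
      (simp add: sum_distrib_left Const_def mult_single)
  then show ?thesis
    by (auto simp: lookup_sum lookup_single when_def in_keys_iff)
qed

lemma form_subst:
  assumes "form V d F" "\<And>i. i \<in> V \<Longrightarrow> form W 1 (x i)"
  shows "form W d (subst Const x F)"
  using assms(1)
proof (induction rule: form_induct)
  case (zero d)
  then show ?case by (simp add: subst_def graded_0)
qed (use assms(2) in \<open>auto simp: subst_add subst_mult subst_Const subst_Var ring_map_Const
       intro: graded_add form_mult form_Const\<close>)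

section \<open>Linear conditions imposed by one point\<close>

lemma proportional_point:
  assumes "P \<in> proj_space N" "v \<in> P" "u \<in> P"
  shows "\<exists>c. u = (\<lambda>i. c * v i)"
proof -
  have "(v, u) \<in> proportional N"
    by (rule in_quotient_imp_in_rel[OF equiv_proportional]) (use assms in \<open>auto simp: proj_space_def\<close>)
  then show ?thesis by (auto simp: proportional_def)
qed

lemma proj_point_nonzero:
  assumes "P \<in> proj_space N"
  obtains v where "v \<in> P" "v \<in> nonzero_vectors N"
proof -
  have P: "P \<in> nonzero_vectors N // proportional N" using assms by (simp add: proj_space_def)
  obtain v where "v \<in> P"
    using in_quotient_imp_non_empty[OF equiv_proportional P] by blast
  with in_quotient_imp_subset[OF equiv_proportional P] show ?thesis using that by blast
qed

text \<open>For a monomial in the variables up to \<open>N\<close>, this is its multiplicity at the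
  point whose only nonzero coordinate has index \<open>j\<close>.\<close>

definition excess :: "nat \<Rightarrow> nat \<Rightarrow> (nat \<Rightarrow>\<^sub>0 nat) \<Rightarrow> nat"
  where "excess N j e = (\<Sum>i\<in>{..N} - {j}. Poly_Mapping.lookup e i)"

lemma total_deg_excess:
  "Poly_Mapping.keys e \<subseteq> {..N} \<Longrightarrow> j \<le> N \<Longrightarrow>
    total_deg e = Poly_Mapping.lookup e j + excess N j e"
  unfolding excess_def total_deg_eq by (subst sum.remove[of _ j]) auto

text \<open>Monomials of degree \<open>d\<close> with small excess are turned into monomials of degree \<open>k\<close>
  by adjusting the exponent of the variable \<open>j\<close>.\<close>

lemma card_small_excess:
  assumes "j \<le> N"
  shows "card {e \<in> monomials N d. excess N j e \<le> k} \<le> (k + N) choose N"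
proof -
  define f where "f e = Poly_Mapping.update j (k - excess N j e) e" for e
  have ex: "excess N j (f e) = excess N j e" for e
    unfolding excess_def f_def by (intro sum.cong) (auto simp: lookup_update)
  \<comment> \<open>\<open>f\<close> changes only the exponent of \<open>j\<close>, which is
    recovered from the excess and the common degree \<open>d\<close>.\<close>
  have "inj_on f {e \<in> monomials N d. excess N j e \<le> k}"
  proof (rule inj_onI)
    fix a b assume *: "a \<in> {e \<in> monomials N d. excess N j e \<le> k}" "b \<in> {e \<in> monomials N d. excess N j e \<le> k}"
      and f: "f a = f b"
    have 1: "Poly_Mapping.lookup a i = Poly_Mapping.lookup b i" if "i \<noteq> j" for i
      using arg_cong[OF f, of "\<lambda>e. Poly_Mapping.lookup e i"] that by (simp add: f_def lookup_update)
    have "excess N j a = excess N j b" using ex[of a] ex[of b] f by simp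
    then have 2: "Poly_Mapping.lookup a j = Poly_Mapping.lookup b j"
      using total_deg_excess[of a N j] total_deg_excess[of b N j] * assms by (simp add: monomials_def)
    show "a = b" using 1 2 by (intro poly_mapping_eqI) metis
  qed
  moreover have "f ` {e \<in> monomials N d. excess N j e \<le> k} \<subseteq> monomials N k"
  proof safe
    fix e assume e: "e \<in> monomials N d" "excess N j e \<le> k"
    have k: "Poly_Mapping.keys (f e) \<subseteq> {..N}"
      using e assms unfolding f_def monomials_def by (auto simp: in_keys_iff lookup_update subset_iff)
    moreover have "Poly_Mapping.lookup (f e) j = k - excess N j e"
      by (simp add: f_def lookup_update)
    ultimately show "f e \<in> monomials N k"
      using total_deg_excess[OF k assms] e ex[of e] by (simp add: monomials_def)
  qed
  ultimately have "card {e \<in> monomials N d. excess N j e \<le> k} \<le> card (monomials N k)"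
    by (rule card_inj_on_le) (rule finite_monomials)
  then show ?thesis by (simp add: card_monomials)
qed

text \<open>In the coordinates \<open>x_i - (v_i/v_j) x_j\<close>, the ideal of the point is generated by variables.\<close>

lemma point_conditions:
  assumes "P \<in> proj_space N"
  obtains j x where "j \<le> N"
    "\<And>m F. form {..N} d F \<Longrightarrow>
       (\<And>e. e \<in> monomials N d \<Longrightarrow> excess N j e < m \<Longrightarrow> Poly_Mapping.lookup (subst Const x F) e = 0) \<Longrightarrow>
       F \<in> ipow N P m"
proof -
  obtain v where v: "v \<in> P" "v \<in> nonzero_vectors N" using proj_point_nonzero[OF assms] .
  then obtain j where vj: "v j \<noteq> 0" and j: "j \<le> N" unfolding nonzero_vectors_def by (auto simp: not_less[symmetric])
  \<comment> \<open>Mutually inverse linear changes of variables; for \<open>i \<noteq> j\<close>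
    the form \<open>y i\<close> vanishes at every multiple of \<open>v\<close>.\<close>
  define x :: "nat \<Rightarrow> nat mpoly" where "x i = (if i = j then Var j else Var i + Const (v i / v j) * Var j)" for i
  define y :: "nat \<Rightarrow> nat mpoly" where "y i = (if i = j then Var j else Var i - Const (v i / v j) * Var j)" for i
  have form: "form {..N} 1 (x i)" "form {..N} 1 (y i)" if "i \<le> N" for i
    using that j form_mult[OF form_Const form_Var, of j "{..N}"] unfolding x_def y_def
    by (auto intro: graded_add graded_diff form_Var simp del: One_nat_def)
  \<comment> \<open>\<open>Var j\<close> is nonzero at the point and counts only as a member of the
    zeroth power.\<close>
  have y_mem: "y i \<in> ipow N P (if i = j then 0 else 1)" if i: "i \<le> N" for i
  proof (cases "i = j")
    case True
    then show ?thesis using graded_polys[OF form(2)[OF i]] by (simp only: ipow_0 if_P)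
  next
    case False
    have "eval_poly u (y i) = 0" if "u \<in> P" for u
    proof -
      obtain c where "u = (\<lambda>i. c * v i)" using proportional_point[OF assms v(1) \<open>u \<in> P\<close>] by blast
      then show ?thesis
        using False vj by (simp add: y_def eval_poly_eq_subst ring_map_diff[OF ring_map_subst[OF ring_map_id]]
            subst_mult[OF ring_map_id] subst_Const[OF ring_map_id] subst_Var[OF ring_map_id])
    qed
    then have "y i \<in> point_ideal N P"
      using form(2)[OF i] unfolding point_ideal_def genideal_def form_iff
      by (auto simp: carrier_poly_ring)
    then show ?thesis using False ipow_1 by simp
  qed
  have inv: "subst Const y (subst Const x F) = F" for F
  proof -
    have "subst Const y (x i) = Var i" for i
      by (simp add: x_def subst_add subst_mult subst_Const subst_Var ring_map_Const) (simp add: y_def)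
    then show ?thesis
      by (simp add: ring_map_of_subst[OF ring_map_subst[OF ring_map_Const]] subst_Const[OF ring_map_Const]
          subst_Const_Var)
  qed
  have mem: "F \<in> ipow N P m"
    if F: "form {..N} d F"
      and zero: "\<And>e. e \<in> monomials N d \<Longrightarrow> excess N j e < m \<Longrightarrow> Poly_Mapping.lookup (subst Const x F) e = 0"
    for m F
  proof -
    have keys: "Poly_Mapping.keys (subst Const x F) \<subseteq> monomials N d"
      using form_subst[OF F, of "{..N}" x] form(1) by (simp add: form_keys)
    \<comment> \<open>Each monomial that occurs in the new coordinates has excess at least
      \<open>m\<close>; read back through \<open>y\<close>, it is a product with that many factors
      in the point ideal.\<close>
    have "Const (Poly_Mapping.lookup (subst Const x F) e) *
        (\<Prod>i\<in>Poly_Mapping.keys e. y i ^ Poly_Mapping.lookup e i) \<in> ipow N P m"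
      if e: "e \<in> Poly_Mapping.keys (subst Const x F)" for e
    proof -
      have eN: "Poly_Mapping.keys e \<subseteq> {..N}" using keys e by (auto simp: monomials_def)
      have "y i ^ Poly_Mapping.lookup e i \<in> ipow N P (if i = j then 0 else Poly_Mapping.lookup e i)"
        if "i \<in> Poly_Mapping.keys e" for i
        using ipow_power[OF y_mem[of i], of "Poly_Mapping.lookup e i"] that eN
        by (cases "i = j") (auto simp del: nat_pow_0)
      then have "(\<Prod>i\<in>Poly_Mapping.keys e. y i ^ Poly_Mapping.lookup e i) \<in>
          ipow N P (\<Sum>i\<in>Poly_Mapping.keys e. if i = j then 0 else Poly_Mapping.lookup e i)"
        by (rule ipow_prod)
      also have "(\<Sum>i\<in>Poly_Mapping.keys e. if i = j then 0 else Poly_Mapping.lookup e i) = excess N j e"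
        unfolding excess_def using eN by (intro sum.mono_neutral_cong) (auto simp: in_keys_iff subset_iff)
      finally have 1: "(\<Prod>i\<in>Poly_Mapping.keys e. y i ^ Poly_Mapping.lookup e i) \<in> ipow N P (excess N j e)" .
      have "Const c \<in> ipow N P 0" for c
        unfolding ipow_0 by (rule graded_polys[OF form_Const])
      from ipow_mult[OF this 1] have 2: "Const c * (\<Prod>i\<in>Poly_Mapping.keys e. y i ^ Poly_Mapping.lookup e i)
          \<in> ipow N P (excess N j e)" for c by simp
      have "m \<le> excess N j e"
        using zero[of e] e keys by (force simp: in_keys_iff)
      then show ?thesis using ipow_antimono 2 by blast
    qed
    then have "subst Const y (subst Const x F) \<in> ipow N P m"
      unfolding subst_def[of Const y] by (intro ipow_sum) auto
    then show ?thesis by (simp only: inv)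
  qed
  show ?thesis by (rule that[OF j mem])
qed

text \<open>The unknowns are the coefficients of a form of degree \<open>d\<close>. In coordinates
  adapted to a point, multiplicity \<open>m\<close> is enforced by killing the monomials of excess
  at most \<open>m - 1\<close>, so the hypothesis says that there are fewer equations than
  unknowns.\<close>

lemma symbolic_power_form_exists:
  assumes Z: "finite Z" "Z \<subseteq> proj_space N" and m: "m \<ge> 1"
    and card: "card Z * ((m - 1 + N) choose N) < (d + N) choose N"
  shows "\<exists>F\<in>symbolic_power N Z m. F \<noteq> 0 \<and> homogeneous d F"
proof -
  define good where "good P j x \<longleftrightarrow> j \<le> N \<and> (\<forall>m F. form {..N} d F \<longrightarrow>
      (\<forall>e\<in>monomials N d. excess N j e < m \<longrightarrow> Poly_Mapping.lookup (subst Const x F) e = 0) \<longrightarrow>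
      F \<in> ipow N P m)" for P j and x :: "nat \<Rightarrow> nat mpoly"
  have "\<exists>j x. good P j x" if "P \<in> Z" for P
  proof -
    have "P \<in> proj_space N" using Z that by blast
    then show ?thesis
    proof (rule point_conditions[of P N d])
      fix j and x :: "nat \<Rightarrow> nat mpoly"
      assume jx: "j \<le> N"
        "\<And>m F. form {..N} d F \<Longrightarrow>
         (\<And>e. e \<in> monomials N d \<Longrightarrow> excess N j e < m \<Longrightarrow> Poly_Mapping.lookup (subst Const x F) e = 0) \<Longrightarrow>
         F \<in> ipow N P m"
      show ?thesis
        unfolding good_def
      proof (intro exI conjI allI impI)
        show "j \<le> N" by (rule jx(1))
        fix m F assume F: "form {..N} d F" and zero: "\<forall>e\<in>monomials N d. excess N j e < m \<longrightarrow>
          Poly_Mapping.lookup (subst Const x F) e = 0"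
        show "F \<in> ipow N P m" by (rule jx(2)[OF F]) (use zero in blast)
      qed
    qed
  qed
  then obtain J X where good: "\<And>P. P \<in> Z \<Longrightarrow> good P (J P) (X P)"
    by metis
  have J: "\<And>P. P \<in> Z \<Longrightarrow> J P \<le> N"
    and X: "\<And>P m F. P \<in> Z \<Longrightarrow> form {..N} d F \<Longrightarrow>
       \<forall>e\<in>monomials N d. excess N (J P) e < m \<longrightarrow> Poly_Mapping.lookup (subst Const (X P) F) e = 0 \<Longrightarrow>
       F \<in> ipow N P m"
    using good unfolding good_def by simp_all
  \<comment> \<open>One equation for each point and each monomial to be killed there.\<close>
  define R where "R = (SIGMA P:Z. {e \<in> monomials N d. excess N (J P) e \<le> m - 1})"
  have finR: "finite R" unfolding R_def using Z finite_monomials by auto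
  have "card R = (\<Sum>P\<in>Z. card {e \<in> monomials N d. excess N (J P) e \<le> m - 1})"
    unfolding R_def by (rule card_SigmaI) (use Z finite_monomials in auto)
  also have "\<dots> \<le> (\<Sum>P\<in>Z. (m - 1 + N) choose N)"
    by (rule sum_mono) (rule card_small_excess, rule J)
  finally have cardR: "card R < card (monomials N d)"
    using card unfolding card_monomials by simp
  obtain c where c: "\<exists>e\<in>monomials N d. c e \<noteq> 0"
    and cR: "\<And>r. r \<in> R \<Longrightarrow> (\<Sum>e\<in>monomials N d.
      Poly_Mapping.lookup (subst Const (X (fst r)) (Poly_Mapping.single e 1)) (snd r) * c e) = 0"
    using homogeneous_system_solution[OF finR finite_monomials cardR, where A = "\<lambda>r e.
      Poly_Mapping.lookup (subst Const (X (fst r)) (Poly_Mapping.single e 1)) (snd r)"] by auto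
  define F where "F = (\<Sum>e\<in>monomials N d. Poly_Mapping.single e (c e))"
  have lookF: "Poly_Mapping.lookup F e = (if e \<in> monomials N d then c e else 0)" for e
    unfolding F_def by (simp add: lookup_sum lookup_single when_def finite_monomials sum.delta')
  have F: "form {..N} d F"
    unfolding form_keys by (auto simp: in_keys_iff lookF split: if_splits)
  have "F \<noteq> 0" using c lookF by (metis lookup_zero)
  have "F \<in> ipow N P m" if P: "P \<in> Z" for P
  proof (rule X[OF P F], intro ballI impI)
    fix e' assume e': "e' \<in> monomials N d" "excess N (J P) e' < m"
    have single: "Poly_Mapping.single e (c e) = Const (c e) * Poly_Mapping.single e 1" for e
      by (simp add: Const_def mult_single)
    have "Poly_Mapping.lookup (subst Const (X P) F) e' = (\<Sum>e\<in>monomials N d.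
        c e * Poly_Mapping.lookup (subst Const (X P) (Poly_Mapping.single e 1)) e')"
      unfolding F_def subst_sum[OF ring_map_Const] lookup_sum
      by (simp only: single subst_mult[OF ring_map_Const] subst_Const[OF ring_map_Const] lookup_Const_mult)
    also have "\<dots> = 0"
      using cR[of "(P, e')"] e' P by (simp add: R_def mult.commute)
    finally show "Poly_Mapping.lookup (subst Const (X P) F) e' = 0" .
  qed
  then have "F \<in> symbolic_power N Z m" unfolding symbolic_power_def by blast
  then show ?thesis using \<open>F \<noteq> 0\<close> F unfolding form_iff by blast
qed

section \<open>Degree bounds by cutting with parallel hyperplanes\<close>

text \<open>The bound is uniform in the multiplicity \<open>M\<close>, which is what a statement
  about the Waldschmidt constant requires.\<close>

definition lower_bound :: "nat \<Rightarrow> (nat \<Rightarrow> complex) set \<Rightarrow> real \<Rightarrow> bool"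
  where "lower_bound N T c \<longleftrightarrow> (\<forall>F M d. form {..N} d F \<longrightarrow> F \<noteq> 0 \<longrightarrow>
     (\<forall>v\<in>T. vanishes M v F) \<longrightarrow> c * real M \<le> real d)"

lemma X_power_dvd_iff: "[:0, 1:] ^ n dvd p \<longleftrightarrow> (\<forall>i<n. coeff p i = 0)"
  for p :: "complex poly"
  using monom_1_dvd_iff'[of n p] by (simp add: monom_altdef)

lemma ring_map_map_poly:
  assumes "ring_map h" shows "ring_map (map_poly h)"
proof -
  have h0: "h 0 = 0" using assms by (simp add: ring_map_def)
  have "map_poly h (p * q) = map_poly h p * map_poly h q" for p q
    using assms
    by (intro poly_eqI) (simp add: coeff_map_poly h0 coeff_mult ring_map_sum, simp add: ring_map_def)
  moreover have "map_poly h (p + q) = map_poly h p + map_poly h q" for p q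
    using assms by (intro poly_eqI) (simp add: coeff_map_poly h0, simp add: ring_map_def)
  ultimately show ?thesis
    using assms by (simp add: ring_map_def)
qed

lemma map_poly_pCons2: "ring_map h \<Longrightarrow> map_poly h [:a, b:] = [:h a, h b:]"
  by (intro poly_eqI) (auto simp: coeff_map_poly ring_map_def coeff_pCons split: nat.splits)

lemma map_poly_pCons1: "ring_map h \<Longrightarrow> map_poly h [:a:] = [:h a:]"
  by (intro poly_eqI) (auto simp: coeff_map_poly ring_map_def coeff_pCons split: nat.splits)

text \<open>The coefficients of the polynomial \<open>line v w F\<close> depend polynomially on \<open>w\<close>; hence
  the vanishing order may be tested on the directions outside a hyperplane.\<close>

lemma vanishes_off_hyperplane:
  assumes "\<And>w. w n \<noteq> b w \<Longrightarrow> [:0, 1:] ^ k dvd line v w G"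
    and b: "\<And>w t. b (w(n := t)) = b w"
  shows "vanishes k v G"
  unfolding vanishes_def
proof
  fix w
  show "[:0, 1:] ^ k dvd line v w G"
  proof (cases "w n = b w")
    case False
    then show ?thesis by (rule assms(1))
  next
    case True
    \<comment> \<open>The coefficients of \<open>Q\<close> are polynomials in a second variable,
      which perturbs the \<open>n\<close>-th entry of the direction and leaves \<open>b\<close>
      unchanged.\<close>
    define Q where "Q = subst (\<lambda>c. [:[:c:]:]) (\<lambda>i. [:[:v i:], if i = n then [:w i, 1:] else [:w i:]:]) G"
    have "map_poly (\<lambda>p. poly p t) Q = line v (w(n := w n + t)) G" for t
      unfolding Q_def line_def ring_map_of_subst[OF ring_map_map_poly[OF ring_map_poly]]
      by (simp add: map_poly_pCons2[OF ring_map_poly] map_poly_pCons1[OF ring_map_poly] fun_upd_def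
          if_distrib[of "\<lambda>p. poly p _"] cong: if_cong)
    then have Q: "coeff (line v (w(n := w n + t)) G) i = poly (coeff Q i) t" for t i
      by (metis coeff_map_poly poly_0)
    have "coeff Q i = 0" if "i < k" for i
    proof -
      have "poly (coeff Q i) t = 0" if "t \<noteq> 0" for t
        using assms(1)[of "w(n := w n + t)"] that True \<open>i < k\<close> Q[of t i] by (simp add: b X_power_dvd_iff)
      \<comment> \<open>The factor \<open>[:0, 1:]\<close> takes care of the excluded parameter 0,
        so that the product vanishes everywhere.\<close>
      then have "poly (coeff Q i * [:0, 1:]) t = 0" for t
        by (cases "t = 0") auto
      then have "coeff Q i * [:0, 1:] = 0" using poly_all_0_iff_0 by blast
      then show ?thesis by simp
    qed
    then show ?thesis using Q[of 0] by (simp add: X_power_dvd_iff)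
  qed
qed

text \<open>Restriction to the hyperplane \<open>x_n = a * x_0\<close>, expressed in the remaining
  variables.\<close>

definition cut :: "nat \<Rightarrow> complex \<Rightarrow> nat mpoly \<Rightarrow> nat mpoly"
  where "cut n a = subst Const (\<lambda>i. if i = n then Const a * Var 0 else Var i)"

lemma form_cut:
  assumes "form {..Suc N} d F" shows "form {..N} d (cut (Suc N) a F)"
  unfolding cut_def
  by (rule form_subst[OF assms]) (use form_mult[OF form_Const form_Var, of 0 "{..N}"] in
      \<open>auto intro: form_Var simp del: One_nat_def\<close>)

lemma form_mono: "form V d F \<Longrightarrow> V \<subseteq> W \<Longrightarrow> form W d F"
  by (auto simp: graded_def)

text \<open>Division by the equation of the hyperplane. The product case is a Leibniz rule for the
  difference between a form and its restriction. The clause for \<open>d = 0\<close> compensates for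
  the truncation in \<open>d - 1\<close>.\<close>

lemma cut_division:
  assumes "form {..Suc N} d F"
  obtains G where "form {..Suc N} (d - 1) G" "d = 0 \<Longrightarrow> G = 0"
    "F - cut (Suc N) a F = (Var (Suc N) - Const a * Var 0) * G"
proof -
  let ?L = "Var (Suc N) - Const a * Var 0 :: nat mpoly"
  have rm: "ring_map (cut (Suc N) a)"
    unfolding cut_def by (rule ring_map_subst[OF ring_map_Const])
  from assms have "form {..Suc N} d F \<and>
    (\<exists>G. form {..Suc N} (d - 1) G \<and> (d = 0 \<longrightarrow> G = 0) \<and> F - cut (Suc N) a F = ?L * G)"
  proof (induction rule: form_induct)
    case (zero d)
    show ?case using rm by (intro conjI exI[of _ 0]) (auto simp: ring_map_def graded_0)
  next
    case (add d F G)
    then obtain F' G' where "form {..Suc N} (d - 1) F'" "d = 0 \<longrightarrow> F' = 0" "F - cut (Suc N) a F = ?L * F'"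
      "form {..Suc N} (d - 1) G'" "d = 0 \<longrightarrow> G' = 0" "G - cut (Suc N) a G = ?L * G'" by blast
    moreover have "cut (Suc N) a (F + G) = cut (Suc N) a F + cut (Suc N) a G"
      using rm by (simp add: ring_map_def)
    ultimately show ?case
      using add by (intro conjI exI[of _ "F' + G'"]) (auto simp: graded_add algebra_simps)
  next
    case (Const c)
    show ?case
      by (intro conjI exI[of _ 0]) (auto simp: form_Const graded_0 cut_def subst_Const[OF ring_map_Const])
  next
    case (Var i)
    have one: "form {..Suc N} 0 (1 :: nat mpoly)"
      using form_Const[of _ 1] by (simp add: Const_def)
    show ?case
      using Var one graded_0
      by (intro conjI exI[of _ "if i = Suc N then 1 else 0"])
        (auto simp: cut_def subst_Var[OF ring_map_Const] simp del: One_nat_def intro: form_Var)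
  next
    case (mult d d' F G)
    then obtain F' G' where F': "form {..Suc N} (d - 1) F'" "d = 0 \<longrightarrow> F' = 0" "F - cut (Suc N) a F = ?L * F'"
      and G': "form {..Suc N} (d' - 1) G'" "d' = 0 \<longrightarrow> G' = 0" "G - cut (Suc N) a G = ?L * G'" by blast
    have cut: "cut (Suc N) a (F * G) = cut (Suc N) a F * cut (Suc N) a G"
      using rm by (simp add: ring_map_def)
    have "F * G - cut (Suc N) a (F * G) = (F - cut (Suc N) a F) * G + cut (Suc N) a F * (G - cut (Suc N) a G)"
      unfolding cut by (simp add: algebra_simps)
    also have "\<dots> = ?L * (F' * G + cut (Suc N) a F * G')"
      unfolding F'(3) G'(3) by (simp add: algebra_simps)
    finally have eq: "F * G - cut (Suc N) a (F * G) = ?L * (F' * G + cut (Suc N) a F * G')" .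
    have "form {..Suc N} (d + d' - 1) (F' * G)"
    proof (cases d)
      case (Suc k)
      then show ?thesis using form_mult[OF F'(1), of d' G] mult by simp
    qed (use F'(2) in \<open>simp add: graded_0\<close>)
    moreover have "form {..Suc N} (d + d' - 1) (cut (Suc N) a F * G')"
    proof (cases d')
      case (Suc k)
      have "form {..Suc N} d (cut (Suc N) a F)"
        using form_mono[OF form_cut, of N d F "{..Suc N}"] mult by auto
      from form_mult[OF this G'(1)] Suc show ?thesis by simp
    qed (use G'(2) in \<open>simp add: graded_0\<close>)
    ultimately show ?case
      using mult eq F'(2) G'(2)
      by (intro conjI exI[of _ "F' * G + cut (Suc N) a F * G'"]) (auto simp: form_mult graded_add)
  qed
  then show ?thesis using that by blast
qed

text \<open>The line through \<open>v\<close> with direction \<open>w\<close> is carried to the line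
  through \<open>v(n := a)\<close> with direction \<open>w(n := a * w 0)\<close>, which lies in the
  hyperplane because \<open>v 0 = 1\<close>.\<close>

lemma cut_vanishes:
  assumes "vanishes M (v(n := a)) F" "v 0 = 1" "n \<noteq> 0"
  shows "vanishes M v (cut n a F)"
  unfolding vanishes_def
proof
  fix w
  have "line v w (cut n a F) = line (v(n := a)) (w(n := a * w 0)) F"
    unfolding cut_def ring_map_of_subst[OF ring_map_line]
    by (simp add: line_def subst_Const[OF ring_map_pCons] subst_Var[OF ring_map_pCons]
        subst_mult[OF ring_map_pCons] if_distrib[of "subst _ _"] assms fun_upd_def if_distrib cong: if_cong)
      (auto intro!: arg_cong[where f = "\<lambda>x. subst _ x F"])
  then show "[:0, 1:] ^ M dvd line v w (cut n a F)"
    using assms(1) by (simp add: vanishes_def)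
qed

lemma X_power_dvd_mult_cancel:
  fixes p q :: "complex poly"
  assumes "[:0, 1:] ^ n dvd q * p" "poly q 0 \<noteq> 0"
  shows "[:0, 1:] ^ n dvd p"
proof (cases "p = 0")
  case False
  then have nz: "q * p \<noteq> 0" using assms(2) by auto
  have "n \<le> order 0 (q * p)"
    using assms(1) nz order_divides[of 0 n "q * p"] by simp
  also have "\<dots> = order 0 p" using order_mult[OF nz] assms(2) by (simp add: order_0I)
  finally show ?thesis using order_divides[of 0 n p] by simp
qed simp

lemma line_hyperplane:
  "line v w (Var n - Const a * Var 0) = [:v n - a * v 0, w n - a * w 0:]"
  by (simp add: ring_map_diff[OF ring_map_line])
    (simp add: line_def subst_Const[OF ring_map_pCons] subst_Var[OF ring_map_pCons] subst_mult[OF ring_map_pCons])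

lemma cut_bound:
  assumes "lower_bound N T c" "\<And>v. v \<in> T \<Longrightarrow> v 0 = 1" "form {..Suc N} d F"
    "cut (Suc N) a F \<noteq> 0" "\<And>v. v \<in> T \<Longrightarrow> vanishes M (v(Suc N := a)) F"
  shows "c * real M \<le> real d"
proof -
  have "vanishes M v (cut (Suc N) a F)" if "v \<in> T" for v
    by (rule cut_vanishes[OF assms(5)[OF that] assms(2)[OF that]]) simp
  then show ?thesis using assms(1,4) form_cut[OF assms(3)] unfolding lower_bound_def by blast
qed

text \<open>\<open>b a\<close> counts how often the hyperplane \<open>a\<close> is split off, and
  \<open>D\<close> is the degree left over. A hyperplane with zero restriction is divided out; once
  all restrictions are nonzero, \<open>cut_bound\<close> applies to each slice.\<close>

lemma slices:
  fixes c :: "complex \<Rightarrow> real" and M :: "complex \<Rightarrow> nat"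
  assumes S: "finite S" "\<And>a. a \<in> S \<Longrightarrow> lower_bound N (T a) (c a)" "\<And>a. a \<in> S \<Longrightarrow> c a \<ge> 0"
    "\<And>a v. a \<in> S \<Longrightarrow> v \<in> T a \<Longrightarrow> v 0 = 1"
    and F: "form {..Suc N} d F" "F \<noteq> 0"
    "\<And>a v. a \<in> S \<Longrightarrow> v \<in> T a \<Longrightarrow> vanishes (M a) (v(Suc N := a)) F"
  shows "\<exists>b D. D + (\<Sum>a\<in>S. b a) = d \<and> (\<forall>a\<in>S. c a * (real (M a) - real (b a)) \<le> real D)"
  using F
proof (induction d arbitrary: F M)
  case 0
  \<comment> \<open>In degree 0 the quotient is 0, so \<open>F\<close> equals its own
    restriction.\<close>
  have "cut (Suc N) a F \<noteq> 0" for a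
    using cut_division[OF 0(1), of a] 0(2) by (metis diff_zero mult_zero_right)
  then have "c a * real (M a) \<le> real 0" if "a \<in> S" for a
    using 0(1) 0(3)[OF that] S(2,4)[OF that] by (intro cut_bound[where T = "T a"])
  then show ?case by (intro exI[of _ "\<lambda>_. 0"]) auto
next
  case (Suc d)
  show ?case
  proof (cases "\<exists>a\<in>S. cut (Suc N) a F = 0")
    case False
    then have "cut (Suc N) a F \<noteq> 0" if "a \<in> S" for a using that by blast
    then have "c a * real (M a) \<le> real (Suc d)" if "a \<in> S" for a
      using Suc.prems(1) Suc.prems(3)[OF that] S(2,4)[OF that] that
      by (intro cut_bound[where T = "T a"])
    then show ?thesis by (intro exI[of _ "\<lambda>_. 0"] exI[of _ "Suc d"]) auto
  next
    case True
    then obtain a where a: "a \<in> S" "cut (Suc N) a F = 0" by blast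
    obtain G where G: "form {..Suc N} d G" "F = (Var (Suc N) - Const a * Var 0) * G"
      using cut_division[OF Suc.prems(1), of a] a(2) by (metis diff_Suc_1 diff_zero)
    have "G \<noteq> 0" using G(2) Suc.prems(2) by auto
    have line: "line v w F = [:v (Suc N) - a * v 0, w (Suc N) - a * w 0:] * line v w G" for v w
      unfolding G(2) line_hyperplane[symmetric] using ring_map_line[of v w] by (simp add: ring_map_def)
    \<comment> \<open>Only the points on the hyperplane \<open>a\<close> lose multiplicity, and at
      most one.\<close>
    define M' where "M' = M(a := M a - 1)"
    have "vanishes (M' a') (v(Suc N := a')) G" if a': "a' \<in> S" "v \<in> T a'" for a' v
    proof (cases "a' = a")
      case False
      \<comment> \<open>At these points the linear form has the nonzero value \<open>a' - a\<close>,
        so it contributes no power of the parameter.\<close>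
      have "[:0, 1:] ^ M a' dvd [:a' - a, w (Suc N) - a * w 0:] * line (v(Suc N := a')) w G" for w
        using Suc.prems(3)[OF a', unfolded vanishes_def, rule_format, of w] S(4)[OF a']
        unfolding line[of "v(Suc N := a')"] by (simp del: mult_pCons_left)
      then have "[:0, 1:] ^ M a' dvd line (v(Suc N := a')) w G" for w
        by (rule X_power_dvd_mult_cancel) (use False in auto)
      then show ?thesis using False by (simp add: vanishes_def M'_def)
    next
      case True
      have "vanishes (M a - 1) (v(Suc N := a)) G"
      \<comment> \<open>Along directions inside the hyperplane the linear form is zero and cannot be
        cancelled, so only transversal directions are tested.\<close>
      proof (rule vanishes_off_hyperplane[where n = "Suc N" and b = "\<lambda>w. a * w 0"])
        fix w :: "nat \<Rightarrow> complex" assume w: "w (Suc N) \<noteq> a * w 0"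
        have dvd: "[:0, 1:] ^ M a dvd [:0, w (Suc N) - a * w 0:] * line (v(Suc N := a)) w G"
          using Suc.prems(3)[OF a', unfolded vanishes_def, rule_format, of w] S(4)[OF a'] True
          unfolding line[of "v(Suc N := a')"] by (simp del: mult_pCons_left)
        have X: "[:0, w (Suc N) - a * w 0:] * p = [:0, 1:] * smult (w (Suc N) - a * w 0) p" for p
          by simp
        show "[:0, 1:] ^ (M a - 1) dvd line (v(Suc N := a)) w G"
        proof (cases "M a")
          case (Suc m)
          have "[:0, 1:] * [:0, 1:] ^ m dvd [:0, 1:] * smult (w (Suc N) - a * w 0) (line (v(Suc N := a)) w G)"
            using dvd unfolding X Suc power_Suc .
          then have "[:0, 1:] ^ m dvd smult (w (Suc N) - a * w 0) (line (v(Suc N := a)) w G)"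
            by (subst (asm) dvd_mult_cancel_left) auto
          then show ?thesis using w Suc by (simp add: dvd_smult_iff)
        qed simp
      qed auto
      then show ?thesis using True by (simp add: M'_def)
    qed
    from Suc.IH[OF G(1) \<open>G \<noteq> 0\<close> this] obtain b D where b: "D + sum b S = d"
      and D: "\<And>a'. a' \<in> S \<Longrightarrow> c a' * (real (M' a') - real (b a')) \<le> real D" by blast
    \<comment> \<open>Only an inequality, since \<open>M a - 1\<close> is truncated for
      \<open>M a = 0\<close>; the sign of \<open>c a\<close> enters here.\<close>
    have "c a * (real (M a) - real (Suc (b a))) \<le> c a * (real (M' a) - real (b a))"
      by (rule mult_left_mono) (use S(3) a in \<open>auto simp: M'_def\<close>)
    then have "c a' * (real (M a') - real ((b(a := Suc (b a))) a')) \<le> real D" if "a' \<in> S" for a'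
      using D[OF that] a by (cases "a' = a") (auto simp: M'_def)
    moreover have "sum (b(a := Suc (b a))) S = Suc (sum b S)"
      using S(1) a(1) by (simp add: sum.remove[of S a])
    ultimately show ?thesis using b by (intro exI[of _ "b(a := Suc (b a))"] exI[of _ D]) auto
  qed
qed

section \<open>Special configurations and the bounds they give\<close>

definition affine_vectors :: "nat \<Rightarrow> (nat \<Rightarrow> complex) set"
  where "affine_vectors N = {v. v 0 = 1 \<and> (\<forall>i>N. v i = 0)}"

text \<open>Fewer than \<open>s\<close> points are allowed, since adding points preserves a lower
  bound; \<open>attained_tuple\<close> pads them to a tuple of length \<open>s\<close>.\<close>

definition attained :: "nat \<Rightarrow> nat \<Rightarrow> real \<Rightarrow> bool"
  where "attained N s c \<longleftrightarrow>
    (\<exists>T \<subseteq> affine_vectors N. finite T \<and> card T \<le> s \<and> lower_bound N T c)"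

text \<open>The configuration for the slice \<open>a\<close> is placed on the hyperplane with last
  coordinate \<open>a\<close>. The hypothesis \<open>bound\<close> is the arithmetic that remains
  after \<open>slices\<close>.\<close>

lemma attained_slices:
  fixes c' :: real and c :: "complex \<Rightarrow> real"
  assumes S: "finite S" "\<And>a. a \<in> S \<Longrightarrow> attained N (n a) (c a)" "\<And>a. a \<in> S \<Longrightarrow> c a \<ge> 0"
    and s: "(\<Sum>a\<in>S. n a) \<le> s"
    and bound: "\<And>M D b. (\<And>a. a \<in> S \<Longrightarrow> c a * (real M - real (b a)) \<le> real D) \<Longrightarrow>
      c' * real M \<le> real D + (\<Sum>a\<in>S. real (b a))"
  shows "attained (Suc N) s c'"
proof -
  obtain T where T: "\<And>a. a \<in> S \<Longrightarrow> T a \<subseteq> affine_vectors N \<and> finite (T a) \<and> card (T a) \<le> n a \<and>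
      lower_bound N (T a) (c a)"
    using S(2) unfolding attained_def by metis
  define U where "U = (\<Union>a\<in>S. (\<lambda>v. v(Suc N := a)) ` T a)"
  have "card U \<le> (\<Sum>a\<in>S. card ((\<lambda>v. v(Suc N := a)) ` T a))"
    unfolding U_def by (rule card_UN_le[OF S(1)])
  also have "\<dots> \<le> (\<Sum>a\<in>S. n a)"
    by (rule sum_mono) (use T card_image_le le_trans in blast)
  finally have "card U \<le> s" using s by simp
  moreover have "finite U" unfolding U_def using S(1) T by blast
  moreover have "U \<subseteq> affine_vectors (Suc N)"
    unfolding U_def using T by (fastforce simp: affine_vectors_def)
  moreover have "lower_bound (Suc N) U c'"
    unfolding lower_bound_def
  proof (intro allI impI)
    fix F M d assume F: "form {..Suc N} d F" "F \<noteq> 0" "\<forall>v\<in>U. vanishes M v F"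
    have "\<exists>b D. D + (\<Sum>a\<in>S. b a) = d \<and> (\<forall>a\<in>S. c a * (real M - real (b a)) \<le> real D)"
    proof (rule slices[OF S(1) _ S(3) _ F(1,2)])
      show "lower_bound N (T a) (c a)" if "a \<in> S" for a using T[OF that] by blast
      show "v 0 = 1" if "a \<in> S" "v \<in> T a" for a v
        using T[OF that(1)] that(2) by (auto simp: affine_vectors_def)
      show "vanishes M (v(Suc N := a)) F" if "a \<in> S" "v \<in> T a" for a v
        using F(3) that unfolding U_def by blast
    qed
    then obtain b D where b: "D + (\<Sum>a\<in>S. b a) = d"
      and D: "\<And>a. a \<in> S \<Longrightarrow> c a * (real M - real (b a)) \<le> real D" by blast
    show "c' * real M \<le> real d"
      using bound[OF D] b by (metis of_nat_add of_nat_sum)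
  qed
  ultimately show ?thesis unfolding attained_def by blast
qed

text \<open>In dimension 0 a nonzero form is a multiple of a power of \<open>Var 0\<close> and does
  not vanish at the point. Thus \<open>M = 0\<close>, and every \<open>c\<close> works.\<close>

lemma attained_point: "attained 0 1 c"
proof -
  define v :: "nat \<Rightarrow> complex" where "v = (\<lambda>i. if i = 0 then 1 else 0)"
  have "lower_bound 0 {v} c"
    unfolding lower_bound_def
  proof (intro allI impI)
    fix F :: "nat mpoly" and M d
    assume F: "form {..0} d F" "F \<noteq> 0" "\<forall>v\<in>{v}. vanishes M v F"
    have mon: "e = Poly_Mapping.single 0 d" if "e \<in> Poly_Mapping.keys F" for e
    proof -
      have e: "e \<in> monomials 0 d" using that F(1) unfolding form_keys by blast
      then have "Poly_Mapping.lookup e i = (if i = 0 then d else 0)" for i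
        using total_deg_eq[of e 0] unfolding monomials_def by (auto simp: in_keys_iff subset_iff)
      then show ?thesis by (intro poly_mapping_eqI) (simp add: lookup_single when_def)
    qed
    moreover have "Poly_Mapping.keys F \<noteq> {}" using F(2) by simp
    ultimately have keys: "Poly_Mapping.keys F = {Poly_Mapping.single 0 d}" by blast
    then have "Poly_Mapping.lookup F (Poly_Mapping.single 0 d) \<noteq> 0"
      by (metis in_keys_iff singletonI)
    then have "eval_poly v F \<noteq> 0"
      unfolding eval_poly_def keys by (simp add: v_def)
    then have "coeff (line v w F) 0 \<noteq> 0" for w
      using poly_line[of v w F 0] by (simp add: poly_0_coeff_0)
    then have "M = 0" using F(3) unfolding vanishes_def X_power_dvd_iff by blast
    then show "c * real M \<le> real d" by simp
  qed
  then show ?thesis unfolding attained_def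
    by (intro exI[of _ "{v}"]) (auto simp: affine_vectors_def v_def)
qed

text \<open>Each of \<open>k\<close> parallel hyperplanes carries a grid of \<open>k ^ N\<close>
  points. The inequalities of the slices are summed and divided by \<open>k\<close>.\<close>

lemma attained_grid: "attained N (k ^ N) (real k)"
proof (induction N)
  case 0
  then show ?case using attained_point by simp
next
  case (Suc N)
  define S where "S = (of_nat ` {..<k} :: complex set)"
  have S: "finite S" "card S = k" unfolding S_def by (auto simp: card_image inj_on_def)
  show ?case
  proof (rule attained_slices[OF S(1) Suc.IH])
    fix M D :: nat and b :: "complex \<Rightarrow> nat"
    assume D: "\<And>a. a \<in> S \<Longrightarrow> real k * (real M - real (b a)) \<le> real D"
    have "(\<Sum>a\<in>S. real k * (real M - real (b a))) \<le> (\<Sum>a\<in>S. real D)"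
      using D by (rule sum_mono)
    then have "real k * (real k * real M) \<le> real k * (real D + (\<Sum>a\<in>S. real (b a)))"
      using S(2) by (simp add: sum_distrib_left[symmetric] sum_subtractf algebra_simps)
    then show "real k * real M \<le> real D + (\<Sum>a\<in>S. real (b a))"
      by (cases "k = 0") (auto simp: sum_nonneg)
  qed (use S in auto)
qed

text \<open>The inequalities of all \<open>k + 1\<close> lines are added and divided by
  \<open>k + 1\<close>. On the line with \<open>j\<close> points the coefficient \<open>j\<close> of
  its multiplicity is first raised to \<open>k + 1\<close>, which \<open>j \<le> k\<close>
  permits.\<close>

lemma attained_plane:
  assumes "j \<le> k" shows "attained 2 (k * (k + 1) + j) (real k + real j / (real k + 1))"
proof -
  define S where "S = (of_nat ` {..<k} :: complex set)"
  have S: "finite S" "card S = k" unfolding S_def by (auto simp: card_image inj_on_def)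
  have k: "of_nat k \<notin> S" unfolding S_def by auto
  define n where "n a = (if a = (of_nat k :: complex) then j else k + 1)" for a
  have nS: "n a = k + 1" if "a \<in> S" for a using that k by (auto simp: n_def)
  have "attained (Suc 1) (k * (k + 1) + j) (real k + real j / (real k + 1))"
  proof (rule attained_slices[where S = "insert (of_nat k) S" and n = n and c = "\<lambda>a. real (n a)"])
    show "attained 1 (n a) (real (n a))" for a
      using attained_grid[of 1 "n a"] by simp
    have "sum n S = k * (k + 1)" using S by (simp add: nS)
    then show "sum n (insert (of_nat k) S) \<le> k * (k + 1) + j"
      using S k by (simp add: n_def)
    fix M D :: nat and b :: "complex \<Rightarrow> nat"
    assume D: "\<And>a. a \<in> insert (of_nat k) S \<Longrightarrow> real (n a) * (real M - real (b a)) \<le> real D"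
    have "(\<Sum>a\<in>S. (real k + 1) * (real M - real (b a))) \<le> (\<Sum>a\<in>S. real D)"
      using D nS by (intro sum_mono) (metis insertI2 of_nat_1 of_nat_add)
    then have 1: "(real k + 1) * (real k * real M) \<le> real k * real D + (real k + 1) * (\<Sum>a\<in>S. real (b a))"
      using S(2) by (simp add: sum_distrib_left[symmetric] sum_subtractf sum.distrib algebra_simps)
    have "real j * (real M - real (b (of_nat k))) \<le> real D"
      using D[of "of_nat k"] by (simp add: n_def)
    moreover have "real j * real (b (of_nat k)) \<le> (real k + 1) * real (b (of_nat k))"
      using assms by (intro mult_right_mono) auto
    ultimately have 2: "real j * real M \<le> real D + (real k + 1) * real (b (of_nat k))"
      by (simp add: algebra_simps)
    have "(real k * (real k + 1) + real j) * real M \<le>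
        (real k + 1) * (real D + (\<Sum>a\<in>insert (of_nat k) S. real (b a)))"
      using 1 2 S k by (simp add: algebra_simps)
    then have "(real k * (real k + 1) + real j) * real M / (real k + 1) \<le>
        real D + (\<Sum>a\<in>insert (of_nat k) S. real (b a))"
      by (simp add: divide_le_eq mult.commute)
    then show "(real k + real j / (real k + 1)) * real M \<le> real D + (\<Sum>a\<in>insert (of_nat k) S. real (b a))"
      by (simp add: field_simps)
  qed (use S in auto)
  then show ?thesis by (simp add: numeral_2_eq_2)
qed

section \<open>Specialisation\<close>

definition group_deg :: "nat \<Rightarrow> nat \<Rightarrow> ((nat \<times> nat) \<Rightarrow>\<^sub>0 nat) \<Rightarrow> nat"
  where "group_deg N i e = (\<Sum>j\<le>N. Poly_Mapping.lookup e (i, j))"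

lemma additive_group_deg: "additive_deg (group_deg N i)"
  by (simp add: additive_deg_def group_deg_def lookup_add sum.distrib)

definition multigraded :: "nat \<Rightarrow> nat \<Rightarrow> (nat \<Rightarrow> nat) \<Rightarrow> (nat \<times> nat) mpoly \<Rightarrow> bool"
  where "multigraded N s \<delta> F \<longleftrightarrow> F \<in> polys ({..<s} \<times> {..N}) \<and>
    (\<forall>i<s. graded ({..<s} \<times> {..N}) (group_deg N i) (\<delta> i) F)"

lemma multigraded_multihomogeneous: "multigraded N s \<delta> F \<Longrightarrow> multihomogeneous N s F"
  unfolding multigraded_def multihomogeneous_def graded_def group_deg_def by blast

lemma multigraded_0: "multigraded N s \<delta> 0"
  by (simp add: multigraded_def graded_0 polys_def)

lemma multigraded_add:
  "multigraded N s \<delta> F \<Longrightarrow> multigraded N s \<delta> G \<Longrightarrow> multigraded N s \<delta> (F + G)"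
  by (auto simp: multigraded_def intro: graded_add polys_add)

lemma multigraded_diff:
  "multigraded N s \<delta> F \<Longrightarrow> multigraded N s \<delta> G \<Longrightarrow> multigraded N s \<delta> (F - G)"
  using multigraded_add[of N s \<delta> F "- G"]
  by (simp add: multigraded_def graded_uminus) (simp add: polys_def)

lemma multigraded_sum:
  "(\<And>a. a \<in> A \<Longrightarrow> multigraded N s \<delta> (F a)) \<Longrightarrow> multigraded N s \<delta> (sum F A)"
  by (induction A rule: infinite_finite_induct) (auto simp: multigraded_0 multigraded_add)

lemma multigraded_mult:
  assumes "multigraded N s \<delta> F" "multigraded N s \<delta>' G" "\<And>i. i < s \<Longrightarrow> \<delta>'' i = \<delta> i + \<delta>' i"
  shows "multigraded N s \<delta>'' (F * G)"
  using assms by (auto simp: multigraded_def intro: graded_mult[OF additive_group_deg] polys_mult)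

lemma multigraded_Const: "(\<And>i. i < s \<Longrightarrow> \<delta> i = 0) \<Longrightarrow> multigraded N s \<delta> (Const c)"
  using graded_Const[OF additive_group_deg]
  by (auto simp: multigraded_def intro: graded_polys[OF form_Const])

lemma multigraded_Var:
  assumes "i < s" "j \<le> N" shows "multigraded N s (\<lambda>i'. if i' = i then 1 else 0) (Var (i, j))"
proof -
  have "graded ({..<s} \<times> {..N}) (group_deg N i') (if i' = i then 1 else 0) (Var (i, j))" for i'
    by (rule graded_Var) (use assms in \<open>auto simp: group_deg_def lookup_single when_def\<close>)
  then show ?thesis by (auto simp: multigraded_def intro: graded_polys)
qed

lemma eliminate_column:
  fixes E :: "'r \<Rightarrow> 'c \<Rightarrow> 'a::comm_ring"
  shows "(\<Sum>c\<in>C. (E r0 c0 * E r c - E r c0 * E r0 c) * x c) =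
    E r0 c0 * (\<Sum>c\<in>C. E r c * x c) - E r c0 * (\<Sum>c\<in>C. E r0 c * x c)"
  by (simp add: sum_distrib_left sum_subtractf[symmetric] algebra_simps)

text \<open>Injectivity of a matrix of polynomials at one point propagates to the complement of a
  hypersurface: fraction-free Gaussian elimination, with \<open>G\<close> the product of the pivots.\<close>

lemma injective_off_hypersurface:
  fixes A :: "'r \<Rightarrow> 'c \<Rightarrow> (nat \<times> nat) mpoly"
  assumes "finite C"
    and "\<And>r c. r \<in> R \<Longrightarrow> c \<in> C \<Longrightarrow> multigraded N s (\<delta> r) (A r c)"
    and "\<And>x. (\<And>r. r \<in> R \<Longrightarrow> (\<Sum>c\<in>C. eval_poly z0 (A r c) * x c) = 0) \<Longrightarrow> \<forall>c\<in>C. x c = 0"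
  shows "\<exists>\<epsilon> G. multigraded N s \<epsilon> G \<and> eval_poly z0 G \<noteq> 0 \<and>
    (\<forall>z x. eval_poly z G \<noteq> 0 \<longrightarrow> (\<forall>r\<in>R. (\<Sum>c\<in>C. eval_poly z (A r c) * x c) = 0) \<longrightarrow>
       (\<forall>c\<in>C. x c = 0))"
  using assms
\<comment> \<open>The induction runs over the columns, so the set \<open>R\<close> of rows may be
  infinite.\<close>
proof (induction C arbitrary: A \<delta> rule: finite_induct)
  case empty
  have "multigraded N s (\<lambda>_. 0) (Const 1)" by (rule multigraded_Const) simp
  moreover have "eval_poly z0 (Const 1) \<noteq> 0"
    by (simp add: eval_poly_eq_subst subst_Const[OF ring_map_id])
  ultimately show ?case by blast
next
  case (insert c0 C)
  have hom: "ring_map (eval_poly z)" for z :: "nat \<times> nat \<Rightarrow> complex"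
    unfolding eval_poly_eq_subst by (rule ring_map_subst[OF ring_map_id])
  have sum: "(\<Sum>c\<in>insert c0 C. f c) = f c0 + (\<Sum>c\<in>C. f c)" for f :: "'c \<Rightarrow> complex"
    using insert.hyps by simp
  \<comment> \<open>A pivot exists, since otherwise the unit vector at \<open>c0\<close> would lie
    in the kernel at \<open>z0\<close>.\<close>
  have "\<exists>r0\<in>R. eval_poly z0 (A r0 c0) \<noteq> 0"
  proof (rule ccontr)
    assume *: "\<not> ?thesis"
    have "\<forall>c\<in>insert c0 C. (if c = c0 then 1 else 0 :: complex) = 0"
      by (rule insert.prems(2)) (use * insert.hyps in \<open>auto simp: sum intro!: sum.neutral\<close>)
    then show False by simp
  qed
  then obtain r0 where r0: "r0 \<in> R" "eval_poly z0 (A r0 c0) \<noteq> 0" by blast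
  \<comment> \<open>Cross-multiplication with the pivot row clears the column \<open>c0\<close>
    without division and keeps the entries multihomogeneous.\<close>
  define B where "B r c = A r0 c0 * A r c - A r c0 * A r0 c" for r c
  have evB: "eval_poly z (B r c) = eval_poly z (A r0 c0) * eval_poly z (A r c) -
      eval_poly z (A r c0) * eval_poly z (A r0 c)" for z r c
    unfolding B_def ring_map_diff[OF hom] using hom[of z] by (simp add: ring_map_def)
  have B: "multigraded N s (\<lambda>i. \<delta> r0 i + \<delta> r i) (B r c)" if "r \<in> R" "c \<in> C" for r c
    unfolding B_def
    by (intro multigraded_diff multigraded_mult[OF insert.prems(1) insert.prems(1)]) (use that r0 in auto)
  have inj: "\<forall>c\<in>C. y c = 0"
    if y: "\<And>r. r \<in> R \<Longrightarrow> (\<Sum>c\<in>C. eval_poly z0 (B r c) * y c) = 0" for y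
  proof -
    define S where "S r = (\<Sum>c\<in>C. eval_poly z0 (A r c) * y c)" for r
    \<comment> \<open>A kernel vector of \<open>B\<close> at \<open>z0\<close> is extended to one of
      \<open>A\<close> by solving the pivot row for the entry at \<open>c0\<close>.\<close>
    define x where "x = y(c0 := - S r0 / eval_poly z0 (A r0 c0))"
    have x: "(\<Sum>c\<in>C. eval_poly z0 (A r c) * x c) = S r" for r
      unfolding S_def x_def using insert.hyps by (intro sum.cong) auto
    have "eval_poly z0 (A r0 c0) * S r - eval_poly z0 (A r c0) * S r0 = 0" if "r \<in> R" for r
      using y[OF that] unfolding evB eliminate_column[where E = "\<lambda>r c. eval_poly z0 (A r c)"] S_def .
    then have "(\<Sum>c\<in>insert c0 C. eval_poly z0 (A r c) * x c) = 0" if "r \<in> R" for r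
      unfolding sum x using that r0 by (auto simp: x_def field_simps)
    from insert.prems(2)[OF this] show ?thesis
      using insert.hyps by (auto simp: x_def split: if_splits)
  qed
  have "\<exists>\<epsilon> G. multigraded N s \<epsilon> G \<and> eval_poly z0 G \<noteq> 0 \<and>
    (\<forall>z x. eval_poly z G \<noteq> 0 \<longrightarrow> (\<forall>r\<in>R. (\<Sum>c\<in>C. eval_poly z (B r c) * x c) = 0) \<longrightarrow>
       (\<forall>c\<in>C. x c = 0))"
    by (rule insert.IH[where A = B and \<delta> = "\<lambda>r i. \<delta> r0 i + \<delta> r i", OF B inj])
  then obtain \<epsilon> G where G: "multigraded N s \<epsilon> G" "eval_poly z0 G \<noteq> 0"
    and Gz: "\<forall>z x. eval_poly z G \<noteq> 0 \<longrightarrow> (\<forall>r\<in>R. (\<Sum>c\<in>C. eval_poly z (B r c) * x c) = 0) \<longrightarrow>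
       (\<forall>c\<in>C. x c = 0)"
    by (elim exE conjE)
  have ev: "eval_poly z (A r0 c0 * G) = eval_poly z (A r0 c0) * eval_poly z G" for z
    using hom[of z] by (simp add: ring_map_def)
  have "multigraded N s (\<lambda>i. \<delta> r0 i + \<epsilon> i) (A r0 c0 * G)"
    by (rule multigraded_mult[OF insert.prems(1) G(1)]) (use r0 in auto)
  moreover have "\<forall>c\<in>insert c0 C. x c = 0"
    if z: "eval_poly z (A r0 c0 * G) \<noteq> 0"
      and x: "\<forall>r\<in>R. (\<Sum>c\<in>insert c0 C. eval_poly z (A r c) * x c) = 0" for z x
  proof -
    have S: "(\<Sum>c\<in>C. eval_poly z (A r c) * x c) = - (eval_poly z (A r c0) * x c0)" if "r \<in> R" for r
      using x that unfolding sum by (metis add_eq_0_iff)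
    have "(\<Sum>c\<in>C. eval_poly z (B r c) * x c) = 0" if "r \<in> R" for r
      unfolding evB eliminate_column[where E = "\<lambda>r c. eval_poly z (A r c)"] S[OF that] S[OF r0(1)]
      by (simp add: algebra_simps)
    with Gz[rule_format, of z x] z have C: "\<forall>c\<in>C. x c = 0" by (simp add: ev)
    then have "eval_poly z (A r0 c0) * x c0 = 0" using S[OF r0(1)] by simp
    with C z show ?thesis by (simp add: ev)
  qed
  ultimately show ?case
    using G(2) r0(2) ev[of z0]
    by (intro exI[of _ "A r0 c0 * G"] exI[of _ "\<lambda>i. \<delta> r0 i + \<epsilon> i"]) auto
qed

text \<open>Expansion in the direction \<open>w\<close> at an indeterminate base point, the
  \<open>i\<close>-th point of the tuple; specialising its coordinates gives
  \<open>line\<close>.\<close>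

definition univ_line :: "nat \<Rightarrow> (nat \<Rightarrow> complex) \<Rightarrow> nat mpoly \<Rightarrow> (nat \<times> nat) mpoly poly"
  where "univ_line i w = subst (\<lambda>c. [:Const c:]) (\<lambda>j. [:Var (i, j), Const (w j):])"

lemma ring_map_pCons_Const: "ring_map (\<lambda>c. [:Const c:])"
  using ring_map_Const by (auto simp: ring_map_def one_pCons)

lemma eval_univ_line:
  "eval_poly z (coeff (univ_line i w F) k) = coeff (line (\<lambda>j. z (i, j)) w F) k"
proof -
  have hom: "ring_map (eval_poly z)"
    unfolding eval_poly_eq_subst by (rule ring_map_subst[OF ring_map_id])
  have "eval_poly z (Const c) = c" "eval_poly z (Var p) = z p" for c p
    by (simp_all add: eval_poly_eq_subst subst_Const[OF ring_map_id] subst_Var[OF ring_map_id])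
  then have "map_poly (eval_poly z) (univ_line i w F) = line (\<lambda>j. z (i, j)) w F"
    unfolding univ_line_def line_def ring_map_of_subst[OF ring_map_map_poly[OF hom]]
    by (simp only: map_poly_pCons1[OF hom] map_poly_pCons2[OF hom])
  moreover have "eval_poly z 0 = 0" using hom unfolding ring_map_def by blast
  then have "coeff (map_poly (eval_poly z) (univ_line i w F)) k = eval_poly z (coeff (univ_line i w F) k)"
    by (rule coeff_map_poly)
  ultimately show ?thesis by simp
qed

text \<open>In the \<open>k\<close>-th coefficient, \<open>k\<close> of the \<open>d\<close>
  variables of each monomial are replaced by constants from \<open>w\<close>. The induction also
  records that coefficients beyond \<open>d\<close> vanish, since the truncated \<open>d - k\<close>
  would otherwise spoil the product case.\<close>

lemma univ_line_multigraded:
  assumes "i < s" "form {..N} d F"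
  shows "multigraded N s (\<lambda>i'. if i' = i then d - k else 0) (coeff (univ_line i w F) k)"
proof -
  have rm: "ring_map (univ_line i w)"
    unfolding univ_line_def by (rule ring_map_subst[OF ring_map_pCons_Const])
  have "\<forall>k. multigraded N s (\<lambda>i'. if i' = i then d - k else 0) (coeff (univ_line i w F) k) \<and>
      (k > d \<longrightarrow> coeff (univ_line i w F) k = 0)"
    using assms(2)
  proof (induction rule: form_induct)
    case (zero d)
    then show ?case using rm by (simp add: ring_map_def multigraded_0)
  next
    case (add d F G)
    then show ?case using rm by (simp add: ring_map_def multigraded_add)
  next
    case (Const c)
    then show ?case
      by (auto simp: univ_line_def subst_Const[OF ring_map_pCons_Const] coeff_pCons multigraded_0
          multigraded_Const split: nat.split)
  next
    case (Var j)
    then show ?case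
      using multigraded_Var[of i s j N] assms(1)
      by (auto simp: univ_line_def subst_Var[OF ring_map_pCons_Const] coeff_pCons multigraded_0
          multigraded_Const split: nat.split cong: if_cong)
  next
    case (mult d d' F G)
    have coeff: "coeff (univ_line i w (F * G)) k =
        (\<Sum>a\<le>k. coeff (univ_line i w F) a * coeff (univ_line i w G) (k - a))" for k
      using rm by (simp add: ring_map_def coeff_mult)
    have "multigraded N s (\<lambda>i'. if i' = i then d + d' - k else 0)
        (coeff (univ_line i w F) a * coeff (univ_line i w G) (k - a))" if "a \<le> k" for a k
    proof (cases "a \<le> d \<and> k - a \<le> d'")
      case True
      then show ?thesis
        using mult that by (intro multigraded_mult[of N s "\<lambda>i'. if i' = i then d - a else 0" _
              "\<lambda>i'. if i' = i then d' - (k - a) else 0"]) auto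
    next
      case False
      then have "coeff (univ_line i w F) a = 0 \<or> coeff (univ_line i w G) (k - a) = 0"
        using mult by (auto simp: not_le)
      then show ?thesis by (auto simp: multigraded_0)
    qed
    moreover have "coeff (univ_line i w F) a * coeff (univ_line i w G) (k - a) = 0"
      if "k > d + d'" "a \<le> k" for a k
    proof -
      have "a > d \<or> k - a > d'" using that by linarith
      then show ?thesis using mult by auto
    qed
    ultimately show ?case unfolding coeff by (auto intro!: multigraded_sum sum.neutral)
  qed
  then show ?thesis by blast
qed

section \<open>From one special tuple to a proper closed set\<close>

lemma lower_boundD:
  assumes "lower_bound N T c" "form {..N} d F" "F \<noteq> 0" "\<forall>v\<in>T. vanishes M v F"
  shows "c * real M \<le> real d"
proof -
  have "form {..N} d F \<longrightarrow> F \<noteq> 0 \<longrightarrow> (\<forall>v\<in>T. vanishes M v F) \<longrightarrow> c * real M \<le> real d"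
    using assms(1) unfolding lower_bound_def by (elim allE)
  then show ?thesis using assms(2-4) by simp
qed

lemma lower_bound_mono:
  assumes "lower_bound N T c" "T \<subseteq> U"
  shows "lower_bound N U c"
  unfolding lower_bound_def
proof (intro allI impI)
  fix F M d assume "form {..N} d F" "F \<noteq> 0" "\<forall>v\<in>U. vanishes M v F"
  moreover from this(3) have "\<forall>v\<in>T. vanishes M v F" using assms(2) by blast
  ultimately show "c * real M \<le> real d"
    using lower_boundD[OF assms(1)] by simp
qed

lemma attained_tuple:
  assumes "attained N s c"
  shows "\<exists>z. (\<forall>i. z i \<in> affine_vectors N) \<and> lower_bound N (z ` {..<s}) c"
proof -
  obtain T where T: "T \<subseteq> affine_vectors N" "finite T" "card T \<le> s" "lower_bound N T c"
    using assms unfolding attained_def by blast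
  obtain f where f: "bij_betw f {0..<card T} T" using ex_bij_betw_nat_finite[OF T(2)] by blast
  \<comment> \<open>Missing entries are filled with the origin of the affine chart.\<close>
  define z where "z i = (if i < card T then f i else (\<lambda>j. if j = 0 then 1 else 0))" for i
  have "z i \<in> affine_vectors N" for i
  proof (cases "i < card T")
    case True
    then show ?thesis using T(1) bij_betwE[OF f] by (auto simp: z_def)
  qed (simp add: z_def affine_vectors_def)
  moreover have "T \<subseteq> z ` {..<s}"
  proof
    fix v assume "v \<in> T"
    then have "v \<in> f ` {0..<card T}" using bij_betw_imp_surj_on[OF f] by simp
    then obtain i where "v = f i" "i \<in> {0..<card T}" by (rule imageE)
    then have "v = z i" "i \<in> {..<s}" using T(3) by (auto simp: z_def)
    then show "v \<in> z ` {..<s}" by (rule image_eqI)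
  qed
  then have "lower_bound N (z ` {..<s}) c"
    by (rule lower_bound_mono[OF T(4)])
  ultimately show ?thesis by (intro exI[of _ z]) simp
qed

lemma line_coeff_sum:
  assumes "F = (\<Sum>e\<in>A. Poly_Mapping.single e (x e))"
  shows "coeff (line v w F) k = (\<Sum>e\<in>A. coeff (line v w (Poly_Mapping.single e 1)) k * x e)"
proof -
  have "line v w (Poly_Mapping.single e (x e)) = smult (x e) (line v w (Poly_Mapping.single e 1))" for e
    by (simp add: line_def subst_single)
  then show ?thesis
    unfolding assms ring_map_sum[OF ring_map_line] by (simp add: coeff_sum mult.commute)
qed

text \<open>Forms of degree \<open>d\<close> with multiplicity \<open>M\<close> at the tuple are the
  kernel of a matrix: the columns are the monomials, the rows the coefficients of order below
  \<open>M\<close> along all lines through the points. The kernel is zero at the special tuple, and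
  \<open>injective_off_hypersurface\<close> supplies the equation \<open>G\<close> of the closed
  set.\<close>

lemma no_form_off_closed_set:
  assumes c: "attained N s c" "real d < c * real M" and s: "s > 0"
  shows "\<exists>A. zariski_closed N s A \<and> A \<noteq> proj_tuples N s \<and>
    (\<forall>P\<in>proj_tuples N s - A. \<forall>F\<in>symbolic_power N (P ` {..<s}) M. homogeneous d F \<longrightarrow> F = 0)"
proof -
  obtain z where z: "\<And>i. z i \<in> affine_vectors N" and low: "lower_bound N (z ` {..<s}) c"
using attained_tuple[OF c(1)] by auto
  define C where "C = monomials N d"
  define R where "R = {..<s} \<times> {..<M} \<times> (UNIV :: (nat \<Rightarrow> complex) set)"
  define A where "A r e = (case r of (i, k, w) \<Rightarrow> coeff (univ_line i w (Poly_Mapping.single e 1)) k)"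
    for r :: "nat \<times> nat \<times> (nat \<Rightarrow> complex)" and e
  define \<delta> where "\<delta> r = (case r of (i, k, w) \<Rightarrow> (\<lambda>i'. if i' = i then d - k else 0))"
    for r :: "nat \<times> nat \<times> (nat \<Rightarrow> complex)"
  have A: "multigraded N s (\<delta> r) (A r e)" if "r \<in> R" "e \<in> C" for r e
  proof -
    have "form {..N} d (Poly_Mapping.single e 1)"
      using that(2) by (simp add: form_keys C_def)
    then show ?thesis
      using univ_line_multigraded[of _ s N d] that(1) by (auto simp: A_def \<delta>_def R_def)
  qed
  have row: "(\<Sum>e\<in>C. eval_poly (\<lambda>(i, j). v i j) (A (i, k, w) e) * x e) =
      coeff (line (v i) w (\<Sum>e\<in>C. Poly_Mapping.single e (x e))) k" for v x i k w
    unfolding line_coeff_sum[OF refl] by (simp add: A_def eval_univ_line)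
  have rows: "(\<forall>r\<in>R. (\<Sum>e\<in>C. eval_poly (\<lambda>(i, j). v i j) (A r e) * x e) = 0) \<longleftrightarrow>
      (\<forall>i<s. vanishes M (v i) (\<Sum>e\<in>C. Poly_Mapping.single e (x e)))" for v x
    unfolding vanishes_def X_power_dvd_iff R_def by (simp add: row) blast
  have lookup: "Poly_Mapping.lookup (\<Sum>e\<in>C. Poly_Mapping.single e (x e)) e = (if e \<in> C then x e else 0)"
    for x :: "_ \<Rightarrow> complex" and e
    by (simp add: lookup_sum lookup_single when_def finite_monomials C_def)
  have inj: "\<forall>e\<in>C. x e = 0"
    if "\<And>r. r \<in> R \<Longrightarrow> (\<Sum>e\<in>C. eval_poly (\<lambda>(i, j). z i j) (A r e) * x e) = 0" for x
  proof -
    define F where "F = (\<Sum>e\<in>C. Poly_Mapping.single e (x e))"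
    have F: "form {..N} d F"
      unfolding form_keys F_def by (auto simp: in_keys_iff lookup C_def[symmetric] split: if_splits)
    have "\<forall>i<s. vanishes M (z i) F"
      using that rows[of z x] unfolding F_def by blast
    then have "\<forall>v\<in>z ` {..<s}. vanishes M v F" by blast
    from lower_boundD[OF low F _ this] c(2) have "F = 0" by force
    then have "Poly_Mapping.lookup F e = 0" for e by simp
    then have *: "(if e \<in> C then x e else 0) = 0" for e unfolding F_def lookup .
    show ?thesis
    proof
      fix e assume "e \<in> C"
      then show "x e = 0" using *[of e] by simp
    qed
  qed
  have "finite C" by (simp add: C_def finite_monomials)
  have "\<exists>\<epsilon> G. multigraded N s \<epsilon> G \<and> eval_poly (\<lambda>(i, j). z i j) G \<noteq> 0 \<and>
    (\<forall>z x. eval_poly z G \<noteq> 0 \<longrightarrow> (\<forall>r\<in>R. (\<Sum>e\<in>C. eval_poly z (A r e) * x e) = 0) \<longrightarrow>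
       (\<forall>e\<in>C. x e = 0))"
    by (rule injective_off_hypersurface[where R = R and \<delta> = \<delta>, OF \<open>finite C\<close> A inj])
  then obtain \<epsilon> G where G: "multigraded N s \<epsilon> G" "eval_poly (\<lambda>(i, j). z i j) G \<noteq> 0"
    and Gv: "\<forall>z x. eval_poly z G \<noteq> 0 \<longrightarrow> (\<forall>r\<in>R. (\<Sum>e\<in>C. eval_poly z (A r e) * x e) = 0) \<longrightarrow>
       (\<forall>e\<in>C. x e = 0)"
    by (elim exE conjE)
  \<comment> \<open>The special tuple, read projectively, lies outside the zero locus of
    \<open>G\<close>, which is therefore proper.\<close>
  define P0 where "P0 = (\<lambda>i\<in>{..<s}. proportional N `` {z i})"
  have zv: "z i \<in> nonzero_vectors N" for i
    using z[of i] by (auto simp: affine_vectors_def nonzero_vectors_def intro!: exI[of _ 0])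
  have "P0 \<in> proj_tuples N s"
    using zv unfolding P0_def proj_tuples_def proj_space_def by (auto intro: quotientI)
  moreover have "z i \<in> P0 i" if "i < s" for i
    using that zv equiv_class_self[OF equiv_proportional] by (simp add: P0_def)
  then have "P0 \<notin> zero_locus N s {G}"
    using G(2) unfolding zero_locus_def by blast
  ultimately have "zero_locus N s {G} \<noteq> proj_tuples N s" by blast
  moreover have "zariski_closed N s (zero_locus N s {G})"
    unfolding zariski_closed_def using multigraded_multihomogeneous[OF G(1)] by blast
  moreover have "F = 0"
    if P: "P \<in> proj_tuples N s - zero_locus N s {G}"
      and F: "F \<in> symbolic_power N (P ` {..<s}) M" "homogeneous d F" for P F
  proof -
    obtain v where v: "\<And>i. i < s \<Longrightarrow> v i \<in> P i" "eval_poly (\<lambda>(i, j). v i j) G \<noteq> 0"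
      using P unfolding zero_locus_def by blast
    have Fi: "F \<in> ipow N (P i) M" if "i < s" for i
      using F(1) that unfolding symbolic_power_def by blast
    \<comment> \<open>By \<open>s > 0\<close> there is at least one point ideal, which confines
      \<open>F\<close> to the variables up to \<open>N\<close>.\<close>
    then have "form {..N} d F"
      using F(2) ipow_subset_polys s unfolding form_iff by blast
    then have keys: "Poly_Mapping.keys F \<subseteq> C" unfolding form_keys C_def .
    have eq: "F = (\<Sum>e\<in>C. Poly_Mapping.single e (Poly_Mapping.lookup F e))"
      using keys by (intro poly_mapping_eqI) (auto simp: lookup in_keys_iff)
    have "\<forall>i<s. vanishes M (v i) F"
      using ipow_vanishes[OF v(1) Fi] by blast
    then have "\<forall>r\<in>R. (\<Sum>e\<in>C. eval_poly (\<lambda>(i, j). v i j) (A r e) * Poly_Mapping.lookup F e) = 0"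
      unfolding rows eq[symmetric] .
    then have "\<forall>e\<in>C. Poly_Mapping.lookup F e = 0" using Gv v(2) by blast
    then show "F = 0" by (subst eq) simp
  qed
  ultimately show ?thesis by (intro exI[of _ "zero_locus N s {G}"]) simp
qed

section \<open>The Waldschmidt constant\<close>

text \<open>Fekete's lemma: the limit is the infimum over \<open>n \<ge> 1\<close>. For
  \<open>p\<close> with ratio close to the infimum, division with remainder
  \<open>n = q * p + r\<close> compares the ratio at \<open>n\<close> with that at
  \<open>p\<close>.\<close>

lemma subadditive_convergent:
  fixes u :: "nat \<Rightarrow> real"
  assumes nonneg: "\<And>n. u n \<ge> 0" and sub: "\<And>m n. u (m + n) \<le> u m + u n"
  shows "convergent (\<lambda>n. u n / real n)"
proof -
  define L where "L = (INF n\<in>{1..}. u n / real n)"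
  have bdd: "bdd_below ((\<lambda>n. u n / real n) ` {1..})"
    by (rule bdd_belowI[of _ 0]) (auto simp: nonneg)
  have "(\<lambda>n. u n / real n) \<longlonglongrightarrow> L"
  proof (rule order_tendstoI)
    fix a assume "a < L"
    have "L \<le> u n / real n" if "n \<ge> 1" for n
      unfolding L_def by (rule cINF_lower[OF bdd]) (use that in auto)
    then show "eventually (\<lambda>n. a < u n / real n) sequentially"
      using \<open>a < L\<close> by (intro eventually_sequentiallyI[of 1]) (meson less_le_trans)
  next
    fix a assume "L < a"
    then obtain p where p: "p \<ge> 1" "u p / real p < a"
      unfolding L_def using cINF_less_iff[OF _ bdd, of a] by auto
    have mult: "u (q * p + r) \<le> real q * u p + u r" for q r
    proof (induction q)
      case (Suc q)
      have "u (Suc q * p + r) \<le> u p + u (q * p + r)"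
        using sub[of p "q * p + r"] by (simp add: add.assoc)
      then show ?case using Suc by (simp add: algebra_simps)
    qed simp
    \<comment> \<open>A common bound for the terms \<open>u r\<close> with \<open>r < p\<close>; its
      contribution \<open>B / real n\<close> tends to 0.\<close>
    define B where "B = (\<Sum>r<p. u r)"
    have bound: "u n / real n \<le> u p / real p + B / real n" if "n \<ge> 1" for n
    proof -
      have "u n \<le> real (n div p) * u p + u (n mod p)"
        using mult[of "n div p" "n mod p"] by simp
      also have "u (n mod p) \<le> B"
        unfolding B_def using p by (intro member_le_sum) (auto simp: nonneg)
      also have "real (n div p) * u p \<le> real n / real p * u p"
        by (rule mult_right_mono) (auto simp: nonneg of_nat_div_le_of_nat)
      finally have "u n \<le> real n / real p * u p + B" by simp
      then have "u n / real n \<le> (real n / real p * u p + B) / real n"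
        by (rule divide_right_mono) simp
      also have "\<dots> = u p / real p + B / real n" using that by (simp add: field_simps)
      finally show ?thesis .
    qed
    have "(\<lambda>n. u p / real p + B / real n) \<longlonglongrightarrow> u p / real p + 0"
      by (intro tendsto_intros lim_const_over_n)
    then have "eventually (\<lambda>n. u p / real p + B / real n < a) sequentially"
      by (rule order_tendstoD) (use p in simp)
    then show "eventually (\<lambda>n. u n / real n < a) sequentially"
      using eventually_ge_at_top[of 1] by eventually_elim (use bound in force)
  qed
  then show ?thesis by (rule convergentI)
qed

text \<open>In positive dimension the number of monomials grows without bound, so in large degree it
  exceeds any number of conditions.\<close>

lemma binomial_ge_Suc: "N \<ge> 1 \<Longrightarrow> (d + N) choose N \<ge> d + 1"
proof (induction d)
  case (Suc d)
  obtain N' where N: "N = Suc N'" using Suc.prems by (cases N) auto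
  have "(Suc d + N) choose N = ((d + N) choose N') + ((d + N) choose N)"
    unfolding N by simp
  moreover have "(d + N) choose N' > 0" unfolding N by simp
  ultimately show ?case using Suc.IH[OF Suc.prems] by linarith
qed simp

section \<open>Least degrees and their asymptotics\<close>

lemma homogeneous_iff_form: "homogeneous d F \<longleftrightarrow> form UNIV d F"
  by (simp add: form_iff polys_def)

text \<open>This makes the \<open>LEAST\<close> in \<open>alpha\<close> meaningful. The dimension
  count asks for positive multiplicity, so it is applied to \<open>Suc m\<close>; this covers
  \<open>m = 0\<close> as well.\<close>

lemma alpha_witness:
  assumes "N \<ge> 1" "finite Z" "Z \<subseteq> proj_space N"
  shows "\<exists>F\<in>symbolic_power N Z m. F \<noteq> 0 \<and> homogeneous (alpha N Z m) F"
proof -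
  have "\<exists>F\<in>symbolic_power N Z (Suc m). F \<noteq> 0 \<and>
      homogeneous (card Z * ((m + N) choose N)) F"
  proof (rule symbolic_power_form_exists[OF assms(2,3)])
    show "card Z * (Suc m - 1 + N choose N) < card Z * (m + N choose N) + N choose N"
      using binomial_ge_Suc[OF assms(1), of "card Z * ((m + N) choose N)"]
      unfolding diff_Suc_1 by linarith
  qed simp
  moreover have "symbolic_power N Z (Suc m) \<subseteq> symbolic_power N Z m"
    unfolding symbolic_power_def by (intro INF_mono' ipow_antimono) simp
  ultimately have "\<exists>F\<in>symbolic_power N Z m. F \<noteq> 0 \<and> homogeneous (card Z * ((m + N) choose N)) F"
    by (meson subsetD)
  then show ?thesis
    unfolding alpha_def
    by (rule LeastI[of "\<lambda>d. \<exists>F\<in>symbolic_power N Z m. F \<noteq> 0 \<and> homogeneous d F"])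
qed

lemma alpha_le: "F \<in> symbolic_power N Z m \<Longrightarrow> F \<noteq> 0 \<Longrightarrow> homogeneous d F \<Longrightarrow> alpha N Z m \<le> d"
  unfolding alpha_def by (rule Least_le) blast

lemma alpha_subadditive:
  assumes "N \<ge> 1" "finite Z" "Z \<subseteq> proj_space N"
  shows "alpha N Z (m + n) \<le> alpha N Z m + alpha N Z n"
proof -
  obtain F G where F: "F \<in> symbolic_power N Z m" "F \<noteq> 0" "homogeneous (alpha N Z m) F"
    and G: "G \<in> symbolic_power N Z n" "G \<noteq> 0" "homogeneous (alpha N Z n) G"
    using alpha_witness[OF assms] by metis
  show ?thesis
  proof (rule alpha_le)
    show "F * G \<in> symbolic_power N Z (m + n)"
      using F(1) G(1) unfolding symbolic_power_def by (auto intro: ipow_mult)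
    show "F * G \<noteq> 0" using F(2) G(2) by simp
    show "homogeneous (alpha N Z m + alpha N Z n) (F * G)"
      using F(3) G(3) unfolding homogeneous_iff_form by (rule form_mult)
  qed
qed

text \<open>Subadditivity makes the sequence converge, so \<open>lim\<close> is a genuine limit and
  inherits the bound.\<close>

lemma waldschmidt_ge:
  assumes "N \<ge> 1" "finite Z" "Z \<subseteq> proj_space N" and c: "\<And>M. c * real M \<le> real (alpha N Z M)"
  shows "c \<le> waldschmidt N Z"
proof -
  have "convergent (\<lambda>M. real (alpha N Z M) / real M)"
    by (rule subadditive_convergent)
      (use alpha_subadditive[OF assms(1-3)] in \<open>simp_all flip: of_nat_add\<close>)
  then have "(\<lambda>M. real (alpha N Z M) / real M) \<longlonglongrightarrow> waldschmidt N Z"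
    unfolding waldschmidt_def by (simp add: convergent_LIMSEQ_iff)
  then show ?thesis
    by (rule LIMSEQ_le_const) (use c in \<open>auto simp: le_divide_eq intro!: exI[of _ 1]\<close>)
qed

text \<open>The exceptional set is the union over the countably many pairs \<open>(M, e)\<close>
  with \<open>e < c * M\<close>. Off it, \<open>c * M\<close> bounds \<open>alpha N Z M\<close> for
  every \<open>M\<close>, hence \<open>c\<close> bounds the Waldschmidt constant, while
  \<open>count\<close> gives \<open>alpha N Z m \<le> d\<close>.\<close>

lemma very_general_bound:
  assumes N: "N \<ge> 1" and s: "s > 0" and m: "m \<ge> 1" and c: "attained N s c"
    and count: "s * ((m - 1 + N) choose N) < (d + N) choose N"
    and le: "(real d + real N - 1) / (real m + real N - 1) \<le> c"
  shows "holds_very_general N s (\<lambda>Z.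
    waldschmidt N Z \<ge> (real (alpha N Z m) + real N - 1) / (real m + real N - 1))"
proof -
  define B where "B = (\<lambda>(M, e). SOME A. zariski_closed N s A \<and> A \<noteq> proj_tuples N s \<and>
    (\<forall>P\<in>proj_tuples N s - A. \<forall>F\<in>symbolic_power N (P ` {..<s}) M. homogeneous e F \<longrightarrow> F = 0))"
  define I where "I = {(M :: nat, e :: nat). real e < c * real M}"
  have B: "zariski_closed N s (B (M, e)) \<and> B (M, e) \<noteq> proj_tuples N s \<and>
    (\<forall>P\<in>proj_tuples N s - B (M, e). \<forall>F\<in>symbolic_power N (P ` {..<s}) M. homogeneous e F \<longrightarrow> F = 0)"
    if "(M, e) \<in> I" for M e
    unfolding B_def prod.case using no_form_off_closed_set[OF c _ s, of e M] that
    by (intro someI_ex[of "\<lambda>A. zariski_closed N s A \<and> A \<noteq> proj_tuples N s \<and>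
      (\<forall>P\<in>proj_tuples N s - A. \<forall>F\<in>symbolic_power N (P ` {..<s}) M. homogeneous e F \<longrightarrow> F = 0)"])
      (simp add: I_def)
  show ?thesis
    unfolding holds_very_general_def
  proof (intro exI[of _ "B ` I"] conjI ballI impI)
    show "countable (B ` I)" by simp
    show "zariski_closed N s A" "A \<noteq> proj_tuples N s" if "A \<in> B ` I" for A
      using that B by auto
    fix P assume P: "P \<in> proj_tuples N s - \<Union> (B ` I)" and "inj_on P {..<s}"
    define Z where "Z = P ` {..<s}"
    have Z: "finite Z" "Z \<subseteq> proj_space N" and card: "card Z = s"
      using P \<open>inj_on P {..<s}\<close> unfolding Z_def proj_tuples_def by (auto simp: card_image)
    have "c * real M \<le> real (alpha N Z M)" for M
    proof (rule ccontr)
      assume "\<not> ?thesis"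
      then have "(M, alpha N Z M) \<in> I" by (simp add: I_def)
      with B[OF this] P have "\<forall>F\<in>symbolic_power N Z M. homogeneous (alpha N Z M) F \<longrightarrow> F = 0"
        unfolding Z_def by blast
      then show False using alpha_witness[OF N Z, of M] by blast
    qed
    then have 1: "c \<le> waldschmidt N Z" by (rule waldschmidt_ge[OF N Z])
    have "alpha N Z m \<le> d"
      using symbolic_power_form_exists[OF Z m, of d] count unfolding card by (auto intro: alpha_le)
    then have "(real (alpha N Z m) + real N - 1) / (real m + real N - 1) \<le>
        (real d + real N - 1) / (real m + real N - 1)"
      using N m by (intro divide_right_mono) auto
    then show "(real (alpha N (P ` {..<s}) m) + real N - 1) / (real m + real N - 1) \<le> waldschmidt N (P ` {..<s})"
      using 1 le unfolding Z_def by linarith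
  qed
qed

section \<open>Counting conditions\<close>

text \<open>The factors of the two products of length \<open>N\<close> are paired symmetrically; after that the claim
  is the inequality between the arithmetic and the geometric mean.\<close>

lemma binomial_count:
  assumes N: "N \<ge> 3" and m: "m \<ge> 1" and k: "k \<ge> m + 1"
  shows "(k + 1) ^ N * ((m - 1 + N) choose N) \<le> (k * (m - 1 + N) + 1) choose N"
proof -
  define M :: real where "M = real (m - 1 + N)"
  \<comment> \<open>The quotient of the \<open>i\<close>-th factors of the two products that
    represent the binomial coefficients.\<close>
  define t where "t i = (real k * M + 1 - real i) / (M - real i)" for i
  have M: "M = real m + real N - 1" using m by (simp add: M_def)
  have pos: "M - real i > 0" if "i < N" for i using that m by (simp add: M)
  have num: "real k * M + 1 - real i > 0" if "i < N" for i
  proof -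
    have "1 * M \<le> real k * M" using k M_def by (intro mult_right_mono) auto
    then show ?thesis using pos[OF that] by linarith
  qed
  have pair: "(real k + 1)\<^sup>2 \<le> t i * t (N - Suc i)" if i: "i < N" for i
  proof -
    \<comment> \<open>\<open>a\<close> and \<open>a'\<close> are the paired denominators with mean
      \<open>\<mu>\<close>, and \<open>c\<close> is the common difference between numerator and
      denominator, so that \<open>t i = (a + c) / a\<close>.\<close>
    define a a' c \<mu> where "a = M - real i" and "a' = M - real (N - Suc i)"
      and "c = (real k - 1) * M + 1" and "\<mu> = (2 * real m + real N - 1) / 2"
    have four: "2\<^sup>2 = (4 :: real)" by simp
    have sum: "a + a' = 2 * \<mu>" using i by (simp add: a_def a'_def \<mu>_def M field_simps)
    have a: "a > 0" "a' > 0" using pos[of i] pos[of "N - Suc i"] i by (simp_all add: a_def a'_def)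
    \<comment> \<open>Here \<open>N \<ge> 3\<close> gives \<open>(N - 1) / 2 \<ge> 1\<close>, and
      \<open>k \<ge> m + 1\<close> gives \<open>m - 1 \<le> k - 2\<close>; together they amount to
      \<open>k * \<mu> \<le> c\<close>.\<close>
    have "(real k - 2) * 1 \<le> (real k - 2) * ((real N - 1) / 2)"
      using N k m by (intro mult_left_mono) auto
    then have "real m - 1 \<le> (real k - 2) * ((real N - 1) / 2)" using k by simp
    then have c: "real k * \<mu> \<le> c" by (simp add: c_def \<mu>_def M field_simps)
    have \<mu>: "\<mu> \<ge> 0" using N by (simp add: \<mu>_def)
    have "4 * (a * a') = (a + a')\<^sup>2 - (a - a')\<^sup>2" by (simp add: power2_eq_square algebra_simps)
    then have "a * a' \<le> \<mu>\<^sup>2" unfolding sum power_mult_distrib four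
      using zero_le_power2[of "a - a'"] by linarith
    then have "((real k + 1)\<^sup>2 - 1) * (a * a') \<le> ((real k + 1)\<^sup>2 - 1) * \<mu>\<^sup>2"
      by (intro mult_left_mono) auto
    also have "\<dots> = 2 * \<mu> * (real k * \<mu>) + (real k * \<mu>)\<^sup>2"
      by (simp add: power2_eq_square algebra_simps)
    also have "\<dots> \<le> 2 * \<mu> * c + c\<^sup>2"
      using c \<mu> by (intro add_mono mult_left_mono power_mono) auto
    finally have "(real k + 1)\<^sup>2 * (a * a') \<le> a * a' + (2 * \<mu>) * c + c\<^sup>2"
      by (simp add: algebra_simps)
    also have "\<dots> = (a + c) * (a' + c)"
      unfolding sum[symmetric] by (simp add: power2_eq_square algebra_simps)
    finally have "(real k + 1)\<^sup>2 \<le> (a + c) * (a' + c) / (a * a')"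
      using a by (simp add: le_divide_eq)
    also have "\<dots> = t i * t (N - Suc i)"
      by (simp add: t_def a_def a'_def c_def algebra_simps)
    finally show ?thesis .
  qed
  have tpos: "t i > 0" if "i < N" for i using pos num that by (simp add: t_def)
  \<comment> \<open>The pairing meets every factor twice, so the squares are compared.\<close>
  have "((real k + 1) ^ N)\<^sup>2 = (\<Prod>i<N. (real k + 1)\<^sup>2)"
    by (simp add: power_mult[symmetric] mult.commute)
  also have "\<dots> \<le> (\<Prod>i<N. t i * t (N - Suc i))"
    by (rule prod_mono) (use pair in auto)
  also have "\<dots> = (\<Prod>i<N. t i)\<^sup>2"
    by (simp add: prod.distrib prod.nat_diff_reindex power2_eq_square)
  finally have "(real k + 1) ^ N \<le> (\<Prod>i<N. t i)"
    by (rule power2_le_imp_le) (intro prod_nonneg less_imp_le tpos, simp)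
  also have "\<dots> = (\<Prod>i<N. real k * M + 1 - real i) / (\<Prod>i<N. M - real i)"
    unfolding t_def by (rule prod_dividef)
  finally have *: "(real k + 1) ^ N * (\<Prod>i<N. M - real i) \<le> (\<Prod>i<N. real k * M + 1 - real i)"
    by (subst (asm) pos_le_divide_eq) (auto intro!: prod_pos dest: pos)
  have binom: "real (n choose N) = (\<Prod>i<N. real n - real i) / fact N" for n
    by (simp add: binomial_gbinomial gbinomial_prod_rev atLeast0LessThan)
  have "real ((k + 1) ^ N * ((m - 1 + N) choose N)) = (real k + 1) ^ N * (\<Prod>i<N. M - real i) / fact N"
    unfolding of_nat_mult binom M_def[symmetric] by (simp add: add.commute)
  also have "\<dots> \<le> (\<Prod>i<N. real k * M + 1 - real i) / fact N"
    using * by (rule divide_right_mono) simp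
  also have "\<dots> = real ((k * (m - 1 + N) + 1) choose N)"
    unfolding binom by (simp add: M_def add.commute)
  finally show ?thesis by (simp only: of_nat_le_iff)
qed

text \<open>With \<open>d = Y - 1\<close>, both binomial coefficients are triangular
  numbers.\<close>

lemma binomial_2_less:
  assumes "s * (m * (m + 1)) < Y * (Y + 1)" "m \<ge> 1" "Y \<ge> 1"
  shows "s * ((m - 1 + 2) choose 2) < ((Y - 1) + 2) choose 2"
proof -
  have two: "2 * (Suc n choose 2) = n * (n + 1)" for n
    by (induction n) (auto simp: numeral_2_eq_2)
  have "2 * (s * (Suc m choose 2)) < 2 * (Suc Y choose 2)"
    using assms(1) two[of m] two[of Y] by (simp add: mult.left_commute[of 2 s])
  then show ?thesis using assms(2,3) by (simp add: numeral_2_eq_2)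
qed

lemma attained_mono: "attained N s c \<Longrightarrow> s \<le> s' \<Longrightarrow> attained N s' c"
  unfolding attained_def by (meson le_trans)

text \<open>\<open>(m + 1) * k + e\<close> is the integral part of
  \<open>(m + 1) * (k + j / (k + 1))\<close>. The loss from rounding is controlled by
  \<open>(m + 1) * j \<le> e * (k + 1) + k\<close>.\<close>

lemma plane_count:
  fixes k m j :: nat
  assumes k: "k \<ge> m + 1" and j: "j \<le> k"
  defines "e \<equiv> (m + 1) * j div (k + 1)"
  shows "(k * (k + 1) + j) * (m * (m + 1)) < ((m + 1) * k + e) * ((m + 1) * k + e + 1)"
proof -
  \<comment> \<open>Integers avoid truncated subtraction in the estimates that follow.\<close>
  define K E J I where "K = int k" and "E = int e" and "J = int j" and "I = int m"
  have nonneg: "K \<ge> I + 1" "E \<ge> 0" "J \<ge> 0" "I \<ge> 0" using k by (auto simp: K_def E_def J_def I_def)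
  have "(m + 1) * j mod (k + 1) \<le> k" using mod_less_divisor[of "k + 1" "(m + 1) * j"] by linarith
  then have "(m + 1) * j \<le> e * (k + 1) + k"
    unfolding e_def using div_mult_mod_eq[of "(m + 1) * j" "k + 1"] by linarith
  then have "int ((m + 1) * j) \<le> int (e * (k + 1) + k)" by (simp only: of_nat_le_iff)
  then have E: "(I + 1) * J - K \<le> E * (K + 1)"
    by (simp add: I_def J_def K_def E_def algebra_simps)
  have 1: "2 * K * ((I + 1) * J - K) \<le> 2 * K * (E * (K + 1))"
    using E nonneg by (intro mult_left_mono) auto
  have 2: "(K + 1) * K * 2 \<le> (K + 1) * K * (K + 1 - I)"
    using nonneg by (intro mult_left_mono) auto
  have "I * 1 \<le> I * K" using nonneg by (intro mult_left_mono) auto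
  then have 3: "0 \<le> J * (K * I + 2 * K - I)"
    using nonneg by (intro mult_nonneg_nonneg) (auto simp: mult.commute)
  have "(K + 1) * (K * K + K * (2 * E + 1) - K * I - I * J) =
      (K + 1) * K * (K + 1 - I) + 2 * K * (E * (K + 1)) - I * J * (K + 1)"
    by (simp add: algebra_simps)
  also have "\<dots> \<ge> (K + 1) * K * 2 + 2 * K * ((I + 1) * J - K) - I * J * (K + 1)"
    using 1 2 by linarith
  also have "(K + 1) * K * 2 + 2 * K * ((I + 1) * J - K) - I * J * (K + 1) =
      2 * K + J * (K * I + 2 * K - I)"
    by (simp add: algebra_simps)
  finally have "0 < (K + 1) * (K * K + K * (2 * E + 1) - K * I - I * J)"
    using 3 nonneg by linarith
  then have "0 < K * K + K * (2 * E + 1) - K * I - I * J"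
    using nonneg by (simp add: zero_less_mult_iff)
  then have "0 < (I + 1) * (K * K + K * (2 * E + 1) - K * I - I * J)"
    using nonneg by (intro mult_pos_pos) auto
  \<comment> \<open>The difference of the two sides of the claim is the preceding product plus this
    term.\<close>
  moreover have "0 \<le> E * (E + 1)" using nonneg by simp
  ultimately have "(K * (K + 1) + J) * (I * (I + 1)) < ((I + 1) * K + E) * ((I + 1) * K + E + 1)"
    by (simp add: algebra_simps)
  then have "int ((k * (k + 1) + j) * (m * (m + 1))) < int (((m + 1) * k + e) * ((m + 1) * k + e + 1))"
    by (simp add: K_def E_def J_def I_def algebra_simps)
  then show ?thesis by (simp only: of_nat_less_iff)
qed

text \<open>In each case \<open>d + N - 1\<close> is the integral part of
  \<open>c * (m + N - 1)\<close>, so the last condition holds by construction and the dimension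
  count is what has to be checked.\<close>

lemma exists_degree:
  fixes N m s :: nat
  assumes N: "N \<ge> 1" and m: "m \<ge> 1" and s: "s \<ge> (m + 1) ^ N"
  shows "\<exists>c d. attained N s c \<and> s * ((m - 1 + N) choose N) < (d + N) choose N \<and>
    (real d + real N - 1) / (real m + real N - 1) \<le> c"
proof -
  have bound: "k \<le> s" if "k ^ N \<le> s" for k
    using that self_le_power[of k N] N by (cases "k = 0") auto
  define k where "k = (GREATEST k. k ^ N \<le> s)"
  have k: "k ^ N \<le> s" "\<And>k'. k' ^ N \<le> s \<Longrightarrow> k' \<le> k"
    unfolding k_def using GreatestI_nat[of "\<lambda>k. k ^ N \<le> s", OF s bound]
      Greatest_le_nat[of "\<lambda>k. k ^ N \<le> s", OF _ bound] by auto
  have km: "k \<ge> m + 1" using k(2) s by blast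
  have less: "s < (k + 1) ^ N" using k(2)[of "k + 1"] by fastforce
  have grid: "attained N s (real k)" by (rule attained_mono[OF attained_grid k(1)])
  consider "N = 1" | "N = 2" "s \<le> k * (k + 1)" | "N = 2" "s > k * (k + 1)" | "N \<ge> 3"
    using N by linarith
  then show ?thesis
  proof cases
    case 1
    then have "k = s" using k(1) less by simp
    then show ?thesis
      using 1 grid m by (intro exI[of _ "real s"] exI[of _ "s * m"]) auto
  next
    case 2
    \<comment> \<open>Here \<open>s\<close> is at most \<open>k * (k + 1)\<close>, so the count for
      \<open>j = 0\<close> suffices.\<close>
    have "s * (m * (m + 1)) \<le> k * (k + 1) * (m * (m + 1))" using 2 by (intro mult_right_mono) auto
    also have "\<dots> < ((m + 1) * k) * ((m + 1) * k + 1)" using plane_count[OF km, of 0] by simp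
    finally have "s * ((m - 1 + 2) choose 2) < ((m + 1) * k - 1 + 2) choose 2"
      using m km by (intro binomial_2_less) auto
    moreover have "real ((m + 1) * k - 1) = (real m + 1) * real k - 1"
      using km by (subst of_nat_diff) (auto simp: algebra_simps)
    ultimately show ?thesis
      using 2 grid by (intro exI[of _ "real k"] exI[of _ "(m + 1) * k - 1"]) (auto simp: divide_le_eq algebra_simps)
  next
    case 3
    define j where "j = s - k * (k + 1)"
    have j: "s = k * (k + 1) + j" using 3 by (simp add: j_def)
    then have jk: "j \<le> k" using less 3(1) by (simp add: power2_eq_square)
    define e where "e = (m + 1) * j div (k + 1)"
    have count: "s * ((m - 1 + 2) choose 2) < ((m + 1) * k + e - 1 + 2) choose 2"
      using plane_count[OF km jk] m km unfolding j e_def by (intro binomial_2_less) auto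
    have d: "real ((m + 1) * k + e - 1) = (real m + 1) * real k + real e - 1"
      using km by (subst of_nat_diff) (auto simp: algebra_simps)
    have "real e \<le> real ((m + 1) * j) / real (k + 1)"
      unfolding e_def by (rule of_nat_div_le_of_nat)
    also have "\<dots> = (real m + 1) * (real j / (real k + 1))"
      by (simp add: algebra_simps)
    finally have "(real m + 1) * real k + real e \<le> (real m + 1) * (real k + real j / (real k + 1))"
      by (simp only: distrib_left)
    then have "((real m + 1) * real k + real e) / (real m + 1) \<le> real k + real j / (real k + 1)"
      by (simp add: pos_divide_le_eq mult.commute)
    then have "(real ((m + 1) * k + e - 1) + real 2 - 1) / (real m + real 2 - 1) \<le>
        real k + real j / (real k + 1)"
      unfolding d by (simp add: add.commute)
    with count attained_plane[OF jk] show ?thesis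
      unfolding 3(1) j[symmetric] by blast
  next
    case 4
    \<comment> \<open>This ensures that the subtraction in
      \<open>d = k * (m - 1 + N) - (N - 1)\<close> is not truncated.\<close>
    have le: "N - 1 \<le> k * (m - 1 + N)"
      using km by (cases k) auto
    have "s * ((m - 1 + N) choose N) < (k + 1) ^ N * ((m - 1 + N) choose N)"
      using less by simp
    also have "\<dots> \<le> (k * (m - 1 + N) + 1) choose N" by (rule binomial_count[OF 4 m km])
    also have "k * (m - 1 + N) + 1 = (k * (m - 1 + N) - (N - 1)) + N" using le N by simp
    finally have "s * ((m - 1 + N) choose N) < ((k * (m - 1 + N) - (N - 1)) + N) choose N" .
    moreover have "real (k * (m - 1 + N) - (N - 1)) = real k * (real m + real N - 1) - (real N - 1)"
      using le N m by (subst of_nat_diff) (auto simp: of_nat_diff)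
    then have "(real (k * (m - 1 + N) - (N - 1)) + real N - 1) / (real m + real N - 1) \<le> real k"
      using N m by (simp add: divide_le_eq)
    ultimately show ?thesis using grid by blast
  qed
qed

theorem mainTheorem1:
  fixes N m s :: nat
  assumes "N \<ge> 1" and "m \<ge> 1" and "s \<ge> (m + 1) ^ N"
  shows "holds_very_general N s (\<lambda>Z.
           waldschmidt N Z \<ge> (real (alpha N Z m) + real N - 1) / (real m + real N - 1))"
proof -
  have "0 < (m + 1) ^ N" by simp
  then have "s > 0" using assms(3) by linarith
  obtain c d where "attained N s c" "s * ((m - 1 + N) choose N) < (d + N) choose N"
    "(real d + real N - 1) / (real m + real N - 1) \<le> c"
    using exists_degree[OF assms] by blast
  then show ?thesis by (rule very_general_bound[OF assms(1) \<open>s > 0\<close> assms(2)])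
qed

end
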